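(* Fix an integer $n\ge2$. There is an action of the cyclic group $\mathcal C_{4n}=\langle g_{4n}\rangle$ of order $4n$ on the cyclic Tamari lattice $\mathsf{CTam}=\mathsf{CTam}_{312}$ satisfying $g_{4n}\cdot x=\mathrm{Row}(x)$ for all $x\in\mathsf{CTam}$. Moreover, the triple $$\left(\mathsf{CTam},\ \mathcal C_{4n},\ \mathrm{Cat}_{B_n}(q)\right)$$ exhibits the cyclic sieving phenomenon.
   Context: Fix an integer $n\ge 2$. A translation-invariant total order (TITO) is a total order $\preceq$ on $\mathbb Z$ such that $a\preceq b$ iff $a+n\preceq b+n$. A reflection index is a pair $(a,b)$ of integers with $a<b$, up to simultaneous translation by multiples of $n$; it is an inversion of $\preceq$ if $b\preceq a$. A TITO is $312$-avoiding if there are no integers $a<b<c$ with $c\preceq a\preceq b$. $\mathsf{CTam}_{312}$ is the set of $312$-avoiding TITOs, partially ordered by containment of inversion sets; it is a finite semidistributive lattice. Rowmotion: for a finite semidistributive lattice $L$, each join-irreducible $j$ covers a unique element $j_*$; set $\kappa(j)=\max\{z\in L\mid z\wedge j=j_*\}$. For each cover $x\lessdot y$ there is a unique join-irreducible $\mathfrak j(x\lessdot y)$ with $\mathfrak j(x\lessdot y)\vee x=y$ and $\kappa(\mathfrak j(x\lessdot y))\wedge y=x$. Let $\mathcal D(u)=\{\mathfrak j(x\lessdot u)\mid x\lessdot u\}$ and $\mathcal U(u)=\{\mathfrak j(u\lessdot y)\mid u\lessdot y\}$. Rowmotion is the unique bijection $\mathrm{Row}\colon L\to L$ with $\mathcal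 D(u)=\mathcal U(\mathrm{Row}(u))$ for all $u\in L$. $[N]_q=\frac{q^N-1}{q-1}$ and $\mathrm{Cat}_{B_N}(q)=\prod_{i=1}^{N}\frac{[2N+2i]_q}{[2i]_q}$ (a polynomial in $q$). For a cyclic group $\mathcal C_\omega=\langle g_\omega\rangle$ of order $\omega$ acting on a finite set $X$ and $F(q)\in\mathbb C[q]$, the triple $(X,\mathcal C_\omega,F(q))$ exhibits the cyclic sieving phenomenon if $|\{x\in X\mid g_\omega^k\cdot x=x\}|=F(e^{2\pi ik/\omega})$ for all $k\in\mathbb Z$. *)

theory Defs
  imports Complex_Main
    "HOL-Library.FuncSet"
    "HOL-Algebra.Lattice"
    "HOL-Algebra.Generated_Groups"
    "HOL-Algebra.Group_Action"
    "HOL-Computational_Algebra.Polynomial"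
    "HOL-Computational_Algebra.Fraction_Field"
begin

section \<open>Translation-invariant total orders and the cyclic Tamari lattice\<close>

text \<open>An order is represented by its set of pairs: \<open>(a, b) \<in> r\<close> means \<open>a \<preceq> b\<close>.\<close>

definition tito :: "nat \<Rightarrow> int rel \<Rightarrow> bool" where
  "tito n r \<longleftrightarrow> linear_order_on UNIV r \<and>
     (\<forall>a b. (a, b) \<in> r \<longleftrightarrow> (a + int n, b + int n) \<in> r)"

text \<open>A reflection index is the class of a pair \<open>a < b\<close> under simultaneous translation by
  multiples of \<open>n\<close>. Pairs with \<open>a \<equiv> b\<close> modulo \<open>n\<close> are allowed.\<close>

definition translation_class :: "nat \<Rightarrow> int \<Rightarrow> int \<Rightarrow> (int \<times> int) set" where
  "translation_class n a b = {(a + k * int n, b + k * int n) | k. True}"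

definition inversion_set :: "nat \<Rightarrow> int rel \<Rightarrow> (int \<times> int) set set" where
  "inversion_set n r = {translation_class n a b | a b. a < b \<and> (b, a) \<in> r}"

definition avoids_312 :: "int rel \<Rightarrow> bool" where
  "avoids_312 r \<longleftrightarrow> \<not> (\<exists>a b c. a < b \<and> b < c \<and> (c, a) \<in> r \<and> (a, b) \<in> r)"

definition CTam :: "nat \<Rightarrow> int rel gorder" where
  "CTam n = \<lparr>carrier = {r. tito n r \<and> avoids_312 r}, eq = (=),
             le = (\<lambda>r s. inversion_set n r \<subseteq> inversion_set n s)\<rparr>"


section \<open>Rowmotion\<close>

text \<open>The definitions below are meant for a finite semidistributive lattice \<open>L\<close> whose equality
  is \<open>(=)\<close>; in that case all descriptions determine their objects uniquely.\<close>

definition covered_by :: "('a, 'm) gorder_scheme \<Rightarrow> 'a \<Rightarrow> 'a \<Rightarrow> bool" where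
  "covered_by L x y \<longleftrightarrow> x \<in> carrier L \<and> y \<in> carrier L \<and> x \<sqsubset>\<^bsub>L\<^esub> y \<and>
     \<not> (\<exists>z\<in>carrier L. x \<sqsubset>\<^bsub>L\<^esub> z \<and> z \<sqsubset>\<^bsub>L\<^esub> y)"

definition join_irreducible :: "('a, 'm) gorder_scheme \<Rightarrow> 'a \<Rightarrow> bool" where
  "join_irreducible L j \<longleftrightarrow> j \<in> carrier L \<and> j \<noteq> \<bottom>\<^bsub>L\<^esub> \<and>
     (\<forall>x\<in>carrier L. \<forall>y\<in>carrier L. x \<squnion>\<^bsub>L\<^esub> y = j \<longrightarrow> x = j \<or> y = j)"

definition lower_cover :: "('a, 'm) gorder_scheme \<Rightarrow> 'a \<Rightarrow> 'a" where
  "lower_cover L j = (THE x. covered_by L x j)"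

definition kappa :: "('a, 'm) gorder_scheme \<Rightarrow> 'a \<Rightarrow> 'a" where
  "kappa L j = (THE z. greatest L z {z \<in> carrier L. z \<sqinter>\<^bsub>L\<^esub> j = lower_cover L j})"

definition cover_label :: "('a, 'm) gorder_scheme \<Rightarrow> 'a \<Rightarrow> 'a \<Rightarrow> 'a" where
  "cover_label L x y =
     (THE j. join_irreducible L j \<and> j \<squnion>\<^bsub>L\<^esub> x = y \<and> kappa L j \<sqinter>\<^bsub>L\<^esub> y = x)"

definition down_labels :: "('a, 'm) gorder_scheme \<Rightarrow> 'a \<Rightarrow> 'a set" where
  "down_labels L u = {cover_label L x u | x. covered_by L x u}"

definition up_labels :: "('a, 'm) gorder_scheme \<Rightarrow> 'a \<Rightarrow> 'a set" where
  "up_labels L u = {cover_label L u y | y. covered_by L u y}"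

text \<open>Extensionality (the value \<open>undefined\<close> outside the carrier) only serves to make the
  bijection unique as a HOL function.\<close>

definition rowmotion :: "('a, 'm) gorder_scheme \<Rightarrow> 'a \<Rightarrow> 'a" where
  "rowmotion L = (THE f. f \<in> extensional (carrier L) \<and> bij_betw f (carrier L) (carrier L) \<and>
     (\<forall>u\<in>carrier L. down_labels L u = up_labels L (f u)))"


section \<open>The type B q-Catalan polynomial\<close>

definition q_int :: "nat \<Rightarrow> complex poly fract" where
  "q_int N = Fract (monom 1 N - 1) (monom 1 1 - 1)"

text \<open>The product is formed among rational functions in \<open>q\<close>; \<open>Cat_B N\<close> is the polynomial equal
  to it.\<close>

definition Cat_B :: "nat \<Rightarrow> complex poly" where
  "Cat_B N = (THE p. Fract p 1 = (\<Prod>i = 1..N. q_int (2 * N + 2 * i) / q_int (2 * i)))"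


section \<open>Cyclic sieving\<close>

definition cyclic_of_order :: "('g, 'm) monoid_scheme \<Rightarrow> 'g \<Rightarrow> nat \<Rightarrow> bool" where
  "cyclic_of_order C g \<omega> \<longleftrightarrow> group C \<and> g \<in> carrier C \<and> carrier C = generate C {g} \<and>
     finite (carrier C) \<and> Coset.order C = \<omega>"

definition cyclic_sieving ::
  "'a set \<Rightarrow> ('g, 'm) monoid_scheme \<Rightarrow> 'g \<Rightarrow> nat \<Rightarrow> ('g \<Rightarrow> 'a \<Rightarrow> 'a) \<Rightarrow> complex poly \<Rightarrow> bool" where
  "cyclic_sieving X C g \<omega> \<phi> F \<longleftrightarrow>
     finite X \<and> cyclic_of_order C g \<omega> \<and> group_action C X \<phi> \<and>
     (\<forall>k::int. of_nat (card {x \<in> X. \<phi> (g [^]\<^bsub>C\<^esub> k) x = x}) =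
        poly F (exp (2 * of_real pi * \<i> * of_int k / of_nat \<omega>)))"

end

theory Submission
  imports Defs "HOL-Algebra.Multiplicative_Group"
begin

text \<open>
  The idea is to replace orders by integer functions, in which covers and their labels can be read
  off, and then by periodic words, on which rowmotion is a rotation.

  In a 312-avoiding TITO the integers \<open>b \<ge> a\<close> that precede \<open>a\<close> form an interval starting at \<open>a\<close>,
  since whatever lies between \<open>a\<close> and such a \<open>b\<close> must precede \<open>a\<close> as well. The right ends \<open>u a\<close> of
  these intervals form a \<^emph>\<open>bracket vector\<close>; it determines the order, and containment of inversion
  sets becomes the pointwise order (\<open>bij_bracket_of\<close>, \<open>CTam_le_iff\<close>). Meets are pointwise minima,
  and a cover changes the bracket vector on a single residue class only.

  The join-irreducibles differ from the identity on one residue class, so they are indexed by arcs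
  \<open>(a, e)\<close> with \<open>a < e \<le> a + n\<close>. The labels of the covers below \<open>u\<close> are the arcs joining each
  position to the next one with the same bracket value; the labels of the covers above \<open>u\<close> are the
  arcs from \<open>a\<close> to \<open>u a + 1\<close>, where \<open>a\<close> is the leftmost position with its (finite) value
  (\<open>down_labels_eq\<close>, \<open>up_labels_eq\<close>). The arcs of the first kind do not cross, and the bracket
  vector whose value at \<open>x\<close> is given by the innermost such arc over \<open>x\<close> has exactly these arcs as
  its arcs of the second kind (\<open>up_arcs_row\<close>). This is rowmotion.

  Both kinds of arcs are determined by their sets of left and right ends. By \<open>fixed_iff_up_arc\<close> and
  \<open>opens_iff_no_down_arc\<close> the right ends of the first kind are the positions that are not left ends
  of the second, and those of the second kind are the successors of the positions that are not left
  ends of the first. So if the word of \<open>u\<close> lists, for one integer \<open>i\<close> after the other, whether \<open>i\<close>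
  is a left end of the second kind and whether it is one of the first kind, then rowmotion shifts
  the word by one letter (\<open>word_row\<close>). The words that occur are those of period \<open>2n\<close> with \<open>n\<close> ones per
  period, each exactly once (\<open>bij_word\<close>); the inverse reads the word as a lattice path and matches
  up-steps with down-steps. Hence rowmotion is conjugate to the rotation of the \<open>n\<close>-element subsets
  of a cycle of length \<open>2n\<close>.

  It remains to compare two numbers. The words fixed by the rotation by \<open>k\<close> are those with period
  \<open>gcd(k, 2n)\<close>. With \<open>d = 2n / gcd(k, 2n)\<close> there are \<open>2n/d\<close> choose \<open>n/d\<close> of them if \<open>d\<close> divides
  \<open>n\<close>, and none otherwise (\<open>card_periodic_words\<close>). On the other side the type B Catalan polynomial is
  the Gaussian binomial coefficient \<open>2n\<close> choose \<open>n\<close> in \<open>q\<^sup>2\<close>, and at \<open>q = exp(2 \<pi> i k / 4n)\<close> the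
  number \<open>q\<^sup>2\<close> is a primitive \<open>d\<close>-th root of unity; cancelling the factors that vanish there leaves
  the same value (\<open>poly_Cat_B_root_of_unity\<close>).
\<close>

section \<open>Bracket vectors\<close>

text \<open>Nested intervals \<open>[x, u x]\<close>. An interval of length at least \<open>n\<close> would have to be infinite, and
  infinity is encoded as \<open>u x = x + n\<close>; this keeps all values integers and makes both periodicity
  and the comparison of values uniform.\<close>

definition bracket :: "nat \<Rightarrow> (int \<Rightarrow> int) \<Rightarrow> bool" where
  "bracket n u \<longleftrightarrow> (\<forall>x. x \<le> u x \<and> u x \<le> x + int n \<and> u (x + int n) = u x + int n \<and>
     (u x < x + int n \<longrightarrow> (\<forall>y. x < y \<and> y \<le> u x \<longrightarrow> u y \<le> u x)))"

lemma bracketI: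
  assumes "\<And>x. x \<le> u x" "\<And>x. u x \<le> x + int n" "\<And>x. u (x + int n) = u x + int n"
    "\<And>x y. u x < x + int n \<Longrightarrow> x < y \<Longrightarrow> y \<le> u x \<Longrightarrow> u y \<le> u x"
  shows "bracket n u"
  using assms unfolding bracket_def by blast

context
  fixes n :: nat and u :: "int \<Rightarrow> int"
  assumes u: "bracket n u" and n: "n > 0"
begin

lemma bracket_ge: "x \<le> u x" and bracket_le: "u x \<le> x + int n"
  and bracket_shift: "u (x + int n) = u x + int n"
  using u by (auto simp: bracket_def)

lemma bracket_nested: "u x < x + int n \<Longrightarrow> x \<le> y \<Longrightarrow> y \<le> u x \<Longrightarrow> u y \<le> u x"
  using u by (cases "x = y") (auto simp: bracket_def)

lemma bracket_shift_mult: "u (x + k * int n) = u x + k * int n"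
proof -
  have nat: "u (x + int m * int n) = u x + int m * int n" for x and m
  proof (induction m)
    case (Suc m)
    then show ?case using bracket_shift[of "x + int m * int n"] by (simp add: algebra_simps)
  qed simp
  show ?thesis
  proof (cases "k \<ge> 0")
    case True then show ?thesis using nat[of x "nat k"] by simp
  next
    case False
    then show ?thesis using nat[of "x + k * int n" "nat (-k)"] by simp
  qed
qed

lemma bracket_closed: "u x < x + int n \<Longrightarrow> u (u x) = u x"
  using bracket_ge[of x] bracket_nested[of x "u x"] bracket_ge[of "u x"] by simp

text \<open>The encoding of infinity causes no confusion: a finite value is a fixed point by
  \<open>bracket_closed\<close>, whereas the value \<open>b + n\<close> of an infinite interval is a position whose own
  interval is infinite.\<close>

lemma bracket_value_finite:
  assumes "u x < x + int n" "u b = u x" shows "u b < b + int n"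
proof (rule ccontr)
  assume "\<not> u b < b + int n"
  then have b: "u b = b + int n" using bracket_le[of b] by simp
  have "u (u x) = u x" using bracket_closed assms(1) by simp
  moreover have "u (b + int n) = b + int n + int n" using bracket_shift b by simp
  ultimately show False using assms b n by simp
qed

end

section \<open>Arcs of a bracket vector and rowmotion on bracket vectors\<close>

definition up_arcs :: "nat \<Rightarrow> (int \<Rightarrow> int) \<Rightarrow> (int \<times> int) set" where
  "up_arcs n u = {(a, e). u a < a + int n \<and> e = u a + 1 \<and> (\<forall>b<a. u b \<noteq> u a)}"

text \<open>Equality of bracket values, where all infinite values count as equal.\<close>

definition same_closing :: "nat \<Rightarrow> (int \<Rightarrow> int) \<Rightarrow> int \<Rightarrow> int \<Rightarrow> bool" where
  "same_closing n u a e \<longleftrightarrow>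
     (if u a = a + int n then u e = e + int n else u e = u a)"

definition down_arcs :: "nat \<Rightarrow> (int \<Rightarrow> int) \<Rightarrow> (int \<times> int) set" where
  "down_arcs n u = {(a, e). a < e \<and> same_closing n u a e \<and>
     (\<forall>x. a < x \<and> x < e \<longrightarrow> \<not> same_closing n u a x)}"

text \<open>The interval of \<open>a\<close> ends in a fixed point of \<open>u\<close>, or else \<open>a + n\<close> also has an infinite interval; so
  some later position has the same value.\<close>

lemma down_arc_exists:
  assumes u: "bracket n u" and n: "n > 0" and a: "a < u a"
  obtains e where "(a, e) \<in> down_arcs n u"
proof -
  define P where "P k \<longleftrightarrow> 0 < k \<and> same_closing n u a (a + int k)" for k
  have "P (nat (u a - a))"
    using a bracket_closed[OF u n, of a] bracket_le[OF u n, of a] bracket_shift[OF u n, of a] 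
    unfolding P_def same_closing_def by auto
  then obtain k where k: "P k" "\<And>j. j < k \<Longrightarrow> \<not> P j" 
    by (metis LeastI not_less_Least)
  have "(a, a + int k) \<in> down_arcs n u"
    unfolding down_arcs_def
  proof (clarsimp, intro conjI allI impI)
    show "0 < k" "same_closing n u a (a + int k)" using k(1) by (auto simp: P_def)
    fix x assume "a < x \<and> x < a + int k"
    then have "nat (x - a) < k" "a < x" by auto
    then show "\<not> same_closing n u a x" using k(2)[of "nat (x - a)"] by (auto simp: P_def)
  qed
  then show ?thesis by (rule that)
qed

lemma down_arc_lt: "(a, e) \<in> down_arcs n u \<Longrightarrow> a < e"
  by (simp add: down_arcs_def)

lemma down_arc_unique:
  "(a, e) \<in> down_arcs n u \<Longrightarrow> (a, e') \<in> down_arcs n u \<Longrightarrow> e = e'"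
  unfolding down_arcs_def by (auto) (meson linorder_neqE)

lemma down_arc_left:
  assumes u: "bracket n u" and n: "n > 0" and a: "(a, e) \<in> down_arcs n u"
  shows "a < u a" and "e \<le> u a" and "e \<le> a + int n"
proof -
  have 1: "a < e" "same_closing n u a e" and 2: "\<And>x. a < x \<Longrightarrow> x < e \<Longrightarrow> \<not> same_closing n u a x"
    using a by (auto simp: down_arcs_def)
  show 3: "e \<le> u a"
  proof (cases "u a = a + int n")
    case True
    then have "same_closing n u a (a + int n)"
      using bracket_shift[OF u n, of a] by (simp add: same_closing_def)
    then show ?thesis using 2[of "a + int n"] n True by force
  next
    case False
    then show ?thesis using 1 bracket_ge[OF u n, of e] by (simp add: same_closing_def)
  qed
  then show "a < u a" "e \<le> a + int n" using 1 bracket_le[OF u n, of a] by auto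
qed

text \<open>A position under the arc has a value different from that of \<open>a\<close>, hence a smaller one; if its
  interval reached \<open>e\<close>, it would contain that of \<open>e\<close>, which ends where that of \<open>a\<close> ends.\<close>

lemma down_arc_inside:
  assumes u: "bracket n u" and n: "n > 0" and a: "(a, e) \<in> down_arcs n u"
    and x: "a < x" "x < e"
  shows "u x < e" "u x < x + int n"
proof -
  have 1: "a < e" "same_closing n u a e" and 2: "\<And>x. a < x \<Longrightarrow> x < e \<Longrightarrow> \<not> same_closing n u a x"
    using a by (auto simp: down_arcs_def)
  have eu: "e \<le> u a" "e \<le> a + int n" using down_arc_left[OF u n a] by auto
  show fin: "u x < x + int n"
  proof (rule ccontr)
    assume *: "\<not> u x < x + int n"
    then have "u x = x + int n" using bracket_le[OF u n, of x] by simp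
    moreover have "u a < a + int n" using 2[OF x] calculation bracket_le[OF u n, of a]
      by (cases "u a = a + int n") (auto simp: same_closing_def)
    moreover have "u x \<le> u a" using bracket_nested[OF u n, of a x] calculation x eu by simp
    ultimately show False using x by simp
  qed
  show "u x < e"
  proof (rule ccontr)
    assume *: "\<not> u x < e"
    then have le: "u e \<le> u x" using bracket_nested[OF u n fin, of e] x by simp
    show False
    proof (cases "u a = a + int n")
      case True
      then have "u e = e + int n" using 1 by (simp add: same_closing_def)
      then show False using le fin x by simp
    next
      case False
      then have "u e = u a" "u a < a + int n" using 1 bracket_le[OF u n, of a] by (auto simp: same_closing_def)
      moreover have "u x \<le> u a" using bracket_nested[OF u n, of a x] calculation x eu by simp
      ultimately have "same_closing n u a x" using le False by (simp add: same_closing_def)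
      then show False using 2 x by blast
    qed
  qed
qed

lemma same_closing_shift:
  assumes u: "bracket n u" and n: "n > 0"
  shows "same_closing n u (a + k * int n) (e + k * int n) = same_closing n u a e"
  by (simp add: same_closing_def bracket_shift_mult[OF u n])

lemma down_arcs_shift:
  assumes u: "bracket n u" and n: "n > 0"
  shows "(a + k * int n, e + k * int n) \<in> down_arcs n u \<longleftrightarrow> (a, e) \<in> down_arcs n u"
proof -
  have "(a + k * int n, e + k * int n) \<in> down_arcs n u" if "(a, e) \<in> down_arcs n u" for a e k
    unfolding down_arcs_def 
  proof (clarsimp, intro conjI allI impI)
    show "a < e" "same_closing n u (a + k * int n) (e + k * int n)"
      using that same_closing_shift[OF u n] by (auto simp: down_arcs_def)
    fix x assume "a + k * int n < x \<and> x < e + k * int n"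
    then have "\<not> same_closing n u a (x - k * int n)" using that by (auto simp: down_arcs_def)
    then show "\<not> same_closing n u (a + k * int n) x"
      using same_closing_shift[OF u n, of a k "x - k * int n"] by simp
  qed
  from this this[of "a + k * int n" "e + k * int n" "-k"] show ?thesis by auto
qed

lemma up_arcs_shift:
  assumes u: "bracket n u" and n: "n > 0"
  shows "(a + k * int n, e + k * int n) \<in> up_arcs n u \<longleftrightarrow> (a, e) \<in> up_arcs n u"
proof -
  have "(a + k * int n, e + k * int n) \<in> up_arcs n u" if "(a, e) \<in> up_arcs n u" for a e k
    unfolding up_arcs_def 
  proof (clarsimp simp: bracket_shift_mult[OF u n], intro conjI allI impI)
    show "u a < a + int n" "e = u a + 1" using that by (auto simp: up_arcs_def)
    fix b assume "b < a + k * int n"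
    then have "u (b - k * int n) \<noteq> u a" using that by (auto simp: up_arcs_def)
    then show "u b \<noteq> u a + k * int n"
      using bracket_shift_mult[OF u n, of "b - k * int n" k] by simp
  qed
  from this this[of "a + k * int n" "e + k * int n" "-k"] show ?thesis by auto
qed

text \<open>Rowmotion on bracket vectors: cover \<open>x\<close> by the arcs \<open>(a, e)\<close>, thought of as the intervals
  \<open>[a, e - 1]\<close>, and take the innermost one. Without such an arc the value is infinite.\<close>

definition bracket_row :: "nat \<Rightarrow> (int \<Rightarrow> int) \<Rightarrow> int \<Rightarrow> int" where
  "bracket_row n u x = Min (insert (x + int n) {e - 1 |a e. (a, e) \<in> down_arcs n u \<and> a \<le> x \<and> x < e})"

context
  fixes n :: nat and u :: "int \<Rightarrow> int"
  assumes u: "bracket n u" and n: "n > 0"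
begin

lemma row_finite: "finite {e - 1 |a e. (a, e) \<in> down_arcs n u \<and> a \<le> x \<and> x < e}"
proof (rule finite_subset)
  show "{e - 1 |a e. (a, e) \<in> down_arcs n u \<and> a \<le> x \<and> x < e} \<subseteq> {x .. x + int n}"
    using down_arc_left(3)[OF u n] by force
qed simp

lemma row_le: "bracket_row n u x \<le> x + int n"
  unfolding bracket_row_def using row_finite by simp

lemma row_le_arc: "(a, e) \<in> down_arcs n u \<Longrightarrow> a \<le> x \<Longrightarrow> x < e \<Longrightarrow> bracket_row n u x \<le> e - 1"
  unfolding bracket_row_def using row_finite by (intro Min_le) auto

lemma row_cases:
  assumes "bracket_row n u x \<noteq> x + int n"
  obtains a e where "(a, e) \<in> down_arcs n u" "a \<le> x" "x < e" "bracket_row n u x = e - 1"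
  using Min_in[of "insert (x + int n) {e - 1 |a e. (a, e) \<in> down_arcs n u \<and> a \<le> x \<and> x < e}"]
    row_finite assms unfolding bracket_row_def[symmetric] by auto

lemma row_shift_le: "bracket_row n u (x + k * int n) \<le> bracket_row n u x + k * int n"
proof (cases "bracket_row n u x = x + int n")
  case True
  then show ?thesis using row_le[of "x + k * int n"] by simp
next
  case False
  then obtain a e where ae: "(a, e) \<in> down_arcs n u" "a \<le> x" "x < e" "bracket_row n u x = e - 1"
    by (rule row_cases)
  then show ?thesis
    using row_le_arc[of "a + k * int n" "e + k * int n" "x + k * int n"] 
      down_arcs_shift[OF u n, of a k e] by simp
qed

lemma bracket_bracket_row: "bracket n (bracket_row n u)"
proof (rule bracketI)
  show "x \<le> bracket_row n u x" for x
    by (cases "bracket_row n u x = x + int n") (auto elim: row_cases[of x])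
  show "bracket_row n u x \<le> x + int n" for x by (rule row_le)
  show "bracket_row n u (x + int n) = bracket_row n u x + int n" for x
    using row_shift_le[of x 1] row_shift_le[of "x + int n" "-1"] by simp
  show "bracket_row n u y \<le> bracket_row n u x" if "bracket_row n u x < x + int n" "x < y" "y \<le> bracket_row n u x" for x y
  proof -
    from that obtain a e where "(a, e) \<in> down_arcs n u" "a \<le> x" "x < e" "bracket_row n u x = e - 1"
      using row_cases[of x] by (metis order_less_irrefl)
    then show ?thesis using row_le_arc[of a e y] that by simp
  qed
qed

lemma down_arcs_noncrossing:
  assumes ae: "(a, e) \<in> down_arcs n u" and "(a', e') \<in> down_arcs n u" and "a' \<le> a" "a < e'"
  shows "e \<le> e'"
proof (cases "a' = a")
  case True
  then show ?thesis using down_arc_unique assms by blast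
next
  case False
  then have "u a < e'" using down_arc_inside(1)[OF u n assms(2), of a] assms by simp
  then show ?thesis using down_arc_left(2)[OF u n ae] by simp
qed

lemma row_at_left_end:
  assumes ae: "(a, e) \<in> down_arcs n u"
  shows "bracket_row n u a = e - 1"
proof (rule antisym)
  show "bracket_row n u a \<le> e - 1" using row_le_arc[OF ae] down_arc_lt[OF ae] by simp
  show "e - 1 \<le> bracket_row n u a"
  proof (cases "bracket_row n u a = a + int n")
    case True then show ?thesis using down_arc_left(3)[OF u n ae] by simp
  next
    case False
    then obtain a' e' where "(a', e') \<in> down_arcs n u" "a' \<le> a" "a < e'" "bracket_row n u a = e' - 1"
      by (rule row_cases)
    then show ?thesis using down_arcs_noncrossing[OF ae, of a' e'] by simp
  qed
qed

lemma down_arcs_inj_right: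
  assumes ae: "(a, e) \<in> down_arcs n u" "(a', e) \<in> down_arcs n u"
  shows "a = a'"
proof -
  have False if ae: "(a, e) \<in> down_arcs n u" "(a', e) \<in> down_arcs n u" and "a' < a" for a a'
  proof -
    have *: "u a < e" using down_arc_inside(1)[OF u n ae(2), of a] that down_arc_lt by blast
    then show False using down_arc_left(2)[OF u n ae(1)] by simp
  qed
  then show ?thesis using assms by (meson linorder_neqE)
qed

text \<open>By noncrossing, the innermost arc over the left end of an arc is that arc itself, and no other
  arc ends at the same place. So the left end of each arc is the leftmost position with its value.\<close>

theorem up_arcs_row: "up_arcs n (bracket_row n u) = down_arcs n u"
proof (rule Set.set_eqI, clarify)
  fix a e
  show "(a, e) \<in> up_arcs n (bracket_row n u) \<longleftrightarrow> (a, e) \<in> down_arcs n u"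
  proof
    assume ae: "(a, e) \<in> down_arcs n u"
    have ra: "bracket_row n u a = e - 1" by (rule row_at_left_end[OF ae])
    have "bracket_row n u b \<noteq> e - 1" if "b < a" for b
    proof
      assume b: "bracket_row n u b = e - 1"
      show False
      proof (cases "bracket_row n u b = b + int n")
        case True
        then show False using ra b bracket_bracket_row bracket_value_finite[OF bracket_bracket_row n, of a b]
            down_arc_left(3)[OF u n ae] by simp
      next
        case False
        then obtain a' where "(a', e) \<in> down_arcs n u" "a' \<le> b"
          using b row_cases[of b] by (metis diff_add_cancel)
        then show False using down_arcs_inj_right[OF ae] that by auto
      qed
    qed
    then show "(a, e) \<in> up_arcs n (bracket_row n u)" 
      using ra down_arc_left(3)[OF u n ae] by (auto simp: up_arcs_def)
  next
    assume "(a, e) \<in> up_arcs n (bracket_row n u)"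
    then have *: "bracket_row n u a < a + int n" "e = bracket_row n u a + 1" "\<forall>b<a. bracket_row n u b \<noteq> bracket_row n u a"
      by (auto simp: up_arcs_def)
    then obtain a' where a': "(a', e) \<in> down_arcs n u" "a' \<le> a"
      using row_cases[of a] by (metis diff_add_cancel order_less_irrefl)
    then have "bracket_row n u a' = bracket_row n u a" using row_at_left_end[OF a'(1)] * by simp
    then have "a' = a" using * a' by force
    then show "(a, e) \<in> down_arcs n u" using a' by simp
  qed
qed

end

section \<open>The periodic word of a bracket vector\<close>

definition opens :: "nat \<Rightarrow> (int \<Rightarrow> int) \<Rightarrow> int \<Rightarrow> bool" where
  "opens n u i \<longleftrightarrow> u i < i + int n \<and> (\<forall>b<i. u b \<noteq> u i)"

text \<open>Letter \<open>2i\<close> marks the left ends of up arcs, letter \<open>2i + 1\<close> those of down arcs. The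
  interleaving is what turns rowmotion into a shift by a single letter.\<close>

definition word :: "nat \<Rightarrow> (int \<Rightarrow> int) \<Rightarrow> int \<Rightarrow> bool" where
  "word n u j = (if even j then opens n u (j div 2) else j div 2 < u (j div 2))"

lemma word_even [simp]: "word n u (2 * i) = opens n u i"
  and word_odd [simp]: "word n u (2 * i + 1) = (i < u i)"
  by (auto simp: word_def)

lemma up_arcs_iff: "(a, e) \<in> up_arcs n u \<longleftrightarrow> opens n u a \<and> e = u a + 1"
  by (auto simp: up_arcs_def opens_def)

lemma same_closing_trans:
  assumes u: "bracket n u" and n: "n > 0" and "same_closing n u a x" "same_closing n u a e"
  shows "same_closing n u x e"
proof (cases "u a = a + int n")
  case True then show ?thesis using assms by (simp add: same_closing_def)
next
  case False
  then have "u a < a + int n" using bracket_le[OF u n, of a] by simp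
  then show ?thesis using assms(3,4) False bracket_value_finite[OF u n, of a x]
    by (auto simp: same_closing_def)
qed

context
  fixes n :: nat and u :: "int \<Rightarrow> int"
  assumes u: "bracket n u" and n: "n > 0"
begin

text \<open>The values taken by finite intervals are the fixed points, so the right ends of up arcs are the
  successors of fixed points, that is, of the positions where no down arc starts.\<close>

lemma fixed_iff_up_arc: "u i = i \<longleftrightarrow> (\<exists>a. (a, i + 1) \<in> up_arcs n u)"
proof
  assume i: "u i = i"
  define P where "P k \<longleftrightarrow> u (i - int n + int k) = i \<and> i - int n + int k \<le> i" for k
  have "P n" using i by (simp add: P_def)
  then obtain k where k: "P k" "\<And>j. j < k \<Longrightarrow> \<not> P j" by (metis LeastI not_less_Least)
  define a where "a = i - int n + int k"
  have a: "u a = i" "a \<le> i" using k(1) by (auto simp: P_def a_def)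
  have fin: "u b < b + int n" if "u b = i" for b
    using bracket_value_finite[OF u n, of i b] i n that by simp
  have "u b \<noteq> i" if "b < a" for b
  proof
    assume b: "u b = i"
    then have "i - int n < b" using fin by fastforce
    moreover have "nat (b - i + int n) < k" using that calculation by (simp add: a_def)
    ultimately show False using k(2)[of "nat (b - i + int n)"] b that a by (simp add: P_def a_def)
  qed
  then have "(a, i + 1) \<in> up_arcs n u" using a fin by (auto simp: up_arcs_def)
  then show "\<exists>a. (a, i + 1) \<in> up_arcs n u" ..
next
  assume "\<exists>a. (a, i + 1) \<in> up_arcs n u"
  then obtain a where "u a < a + int n" "u a = i" by (auto simp: up_arcs_def)
  then show "u i = i" using bracket_closed[OF u n] by metis
qed

text \<open>A position that does not open an up arc has an earlier position with the same value, and the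
  last of these starts a down arc ending here.\<close>

lemma opens_iff_no_down_arc: "opens n u e \<longleftrightarrow> \<not> (\<exists>a. (a, e) \<in> down_arcs n u)"
proof
  assume e: "opens n u e"
  show "\<not> (\<exists>a. (a, e) \<in> down_arcs n u)"
  proof
    assume "\<exists>a. (a, e) \<in> down_arcs n u"
    then obtain a where "a < e" "same_closing n u a e" by (auto simp: down_arcs_def)
    then show False using e by (auto simp: same_closing_def opens_def split: if_splits)
  qed
next
  assume no: "\<not> (\<exists>a. (a, e) \<in> down_arcs n u)"
  show "opens n u e"
  proof (rule ccontr)
    assume "\<not> opens n u e"
    then consider "u e = e + int n" | b where "u e < e + int n" "b < e" "u b = u e"
      using bracket_le[OF u n, of e] by (force simp: opens_def)
    then have "\<exists>a<e. same_closing n u a e"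
    proof cases
      case 1
      then have "same_closing n u (e - int n) e"
        using bracket_shift[OF u n, of "e - int n"] by (simp add: same_closing_def)
      then show ?thesis using n by (intro exI[of _ "e - int n"]) simp
    next
      case 2
      then have "same_closing n u b e"
        using bracket_value_finite[OF u n, of e b] by (simp add: same_closing_def)
      then show ?thesis using 2 by blast
    qed
    then obtain a where a: "a < e" "same_closing n u a e" by blast
    define P where "P k \<longleftrightarrow> 0 < k \<and> same_closing n u (e - int k) e" for k
    have "P (nat (e - a))" using a by (simp add: P_def)
    then obtain k where k: "P k" "\<And>j. j < k \<Longrightarrow> \<not> P j" by (metis LeastI not_less_Least)
    have "(e - int k, e) \<in> down_arcs n u"
      unfolding down_arcs_def
    proof (clarsimp, intro conjI allI impI)
      show "0 < k" "same_closing n u (e - int k) e" using k(1) by (auto simp: P_def)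
      fix x assume x: "e - int k < x \<and> x < e"
      then have "nat (e - x) < k" by auto
      then have "\<not> same_closing n u x e" using k(2)[of "nat (e - x)"] x by (simp add: P_def)
      then show "\<not> same_closing n u (e - int k) x"
        using same_closing_trans[OF u n] k(1) by (auto simp: P_def)
    qed
    then show False using no by blast
  qed
qed

theorem word_row: "word n (bracket_row n u) j = word n u (j + 1)"
proof (cases "even j")
  case True
  then obtain i where j: "j = 2 * i" by (elim evenE)
  have "opens n (bracket_row n u) i \<longleftrightarrow> (\<exists>e. (i, e) \<in> down_arcs n u)"
    using up_arcs_iff[of i _ n "bracket_row n u"] up_arcs_row[OF u n] by auto
  also have "\<dots> \<longleftrightarrow> i < u i"
    using down_arc_left(1)[OF u n] down_arc_exists[OF u n] by metis
  finally show ?thesis by (simp add: j)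
next
  case False
  then obtain i where j: "j = 2 * i + 1" by (elim oddE)
  have "bracket_row n u i = i \<longleftrightarrow> (\<exists>a. (a, i + 1) \<in> up_arcs n (bracket_row n u))"
  proof
    assume i: "bracket_row n u i = i"
    then obtain a e where "(a, e) \<in> down_arcs n u" "a \<le> i" "i < e" "bracket_row n u i = e - 1"
      using row_cases[OF u n, of i] n by (metis add_cancel_left_right of_nat_0_less_iff order_less_irrefl)
    then show "\<exists>a. (a, i + 1) \<in> up_arcs n (bracket_row n u)" using i up_arcs_row[OF u n] by auto
  next
    assume "\<exists>a. (a, i + 1) \<in> up_arcs n (bracket_row n u)"
    then obtain a where a: "(a, i + 1) \<in> down_arcs n u" using up_arcs_row[OF u n] by auto
    then have "bracket_row n u i \<le> i" using row_le_arc[OF u n a, of i] down_arc_lt[OF a] by simp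
    then show "bracket_row n u i = i" using bracket_ge[OF bracket_bracket_row[OF u n] n, of i] by simp
  qed
  then have "i < bracket_row n u i \<longleftrightarrow> opens n u (i + 1)"
    using bracket_ge[OF bracket_bracket_row[OF u n] n, of i] up_arcs_row[OF u n]
      opens_iff_no_down_arc[of "i + 1"] by auto
  moreover have "2 * i + 1 + 1 = 2 * (i + 1)" by simp
  ultimately show ?thesis unfolding j by (simp only: word_odd word_even)
qed

end

text \<open>Infinite descent on the length of the interval of \<open>x\<close>. If \<open>u x < v x\<close>, then \<open>u x\<close> is a fixed point
  of both vectors. The up arc of \<open>v\<close> that closes there starts at some \<open>a > x\<close>; since it also opens
  an up arc of \<open>u\<close>, its value under \<open>u\<close> is smaller than \<open>u x\<close>, and \<open>a\<close> is a shorter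
  counterexample.\<close>

lemma word_eq_imp_le:
  assumes u: "bracket n u" and v: "bracket n v" and n: "n > 0" and w: "word n u = word n v"
  shows "v x \<le> u x"
proof (induction "nat (u x - x)" arbitrary: x rule: less_induct)
  case less
  show ?case
  proof (rule ccontr)
    assume "\<not> v x \<le> u x"
    then have lt: "u x < v x" by simp
    define y where "y = u x"
    have fin: "u x < x + int n" using lt bracket_le[OF v n, of x] by simp
    have "\<not> word n u (2 * y + 1)" using bracket_closed[OF u n fin] by (simp add: y_def)
    then have "v y = y" using w bracket_ge[OF v n, of y] by (simp del: word_even)
    then obtain a where a: "(a, y + 1) \<in> up_arcs n v" using fixed_iff_up_arc[OF v n] by blast
    then have va: "v a = y" "v a < a + int n" "opens n v a" by (auto simp: up_arcs_iff opens_def)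
    then have "a \<le> y" using bracket_ge[OF v n, of a] by simp
    have xa: "x < a"
    proof (rule ccontr)
      assume "\<not> x < a"
      then have "v x \<le> v a" 
        using bracket_nested[OF v n va(2), of x] va bracket_ge[OF u n, of x] by (simp add: y_def)
      then show False using lt va y_def by simp
    qed
    have "word n u (2 * a)" using va(3) w by simp
    then have "u a \<noteq> u x" using xa by (auto simp: opens_def)
    moreover have "u a \<le> u x"
      using bracket_nested[OF u n fin, of a] xa \<open>a \<le> y\<close> by (simp add: y_def)
    ultimately have "u a < y" by (simp add: y_def)
    moreover have "nat (u a - a) < nat (u x - x)"
      using \<open>u a < y\<close> xa bracket_ge[OF u n, of a] by (simp add: y_def)
    ultimately show False using less[of a] va by simp
  qed
qed

theorem word_inj:
  assumes "bracket n u" "bracket n v" "n > 0" "word n u = word n v"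
  shows "u = v"
  using word_eq_imp_le[of n u v] word_eq_imp_le[of n v u] assms by (intro ext antisym) auto

text \<open>The \<open>n\<close>-element subsets of a cycle of length \<open>2n\<close>, as periodic predicates.\<close>

definition words :: "nat \<Rightarrow> (int \<Rightarrow> bool) set" where
  "words n = {w. (\<forall>j. w (j + 2 * int n) = w j) \<and> card {j \<in> {0..<2 * int n}. w j} = n}"

lemma card_even_odd:
  fixes w :: "int \<Rightarrow> bool"
  shows "card {j \<in> {0..<2 * int n}. w j} =
    card {i \<in> {0..<int n}. w (2 * i)} + card {i \<in> {0..<int n}. w (2 * i + 1)}"
proof -
  have "{j \<in> {0..<2 * int n}. w j} =
     (\<lambda>i. 2 * i) ` {i \<in> {0..<int n}. w (2 * i)} \<union> (\<lambda>i. 2 * i + 1) ` {i \<in> {0..<int n}. w (2 * i + 1)}"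
    (is "?A = ?B \<union> ?C")
  proof (rule Set.set_eqI)
    fix j
    show "j \<in> ?A \<longleftrightarrow> j \<in> ?B \<union> ?C"
    proof (cases "even j")
      case True
      then obtain i where j: "j = 2 * i" by (elim evenE)
      have "j \<notin> ?C" using True by auto
      moreover have "j \<in> ?B \<longleftrightarrow> i \<in> {i \<in> {0..<int n}. w (2 * i)}" using j by auto
      ultimately show ?thesis using j by auto
    next
      case False
      then obtain i where j: "j = 2 * i + 1" by (elim oddE)
      have "j \<notin> ?B" using False by auto
      moreover have "j \<in> ?C \<longleftrightarrow> i \<in> {i \<in> {0..<int n}. w (2 * i + 1)}" using j by auto
      ultimately show ?thesis using j by auto
    qed
  qed
  moreover have "card ?B = card {i \<in> {0..<int n}. w (2 * i)}" 
    by (rule card_image) (simp add: inj_on_def)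
  moreover have "card ?C = card {i \<in> {0..<int n}. w (2 * i + 1)}" 
    by (rule card_image) (simp add: inj_on_def)
  moreover have "card (?B \<union> ?C) = card ?B + card ?C"
  proof (rule card_Un_disjoint)
    show "finite ?B" "finite ?C"
      by (rule finite_imageI, rule finite_subset[of _ "{0..<int n}"], auto)+
    show "?B \<inter> ?C = {}" by (auto; presburger)
  qed
  ultimately show ?thesis by (simp only:)
qed

lemma opens_shift:
  assumes u: "bracket n u" and n: "n > 0"
  shows "opens n u (a + k * int n) = opens n u a"
  using up_arcs_shift[OF u n, of a k "u a + 1"] bracket_shift_mult[OF u n, of a k]
  by (simp add: up_arcs_iff)

text \<open>Each fixed point closes exactly one up arc, so sending the left end of an up arc to its value is
  a bijection modulo \<open>n\<close>.\<close>

lemma card_opens: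
  assumes u: "bracket n u" and n: "n > 0"
  shows "card {i \<in> {0..<int n}. opens n u i} = card {i \<in> {0..<int n}. u i = i}"
proof (rule bij_betw_same_card)
  let ?A = "{i \<in> {0..<int n}. opens n u i}" and ?B = "{i \<in> {0..<int n}. u i = i}"
  have mod: "x mod int n = x + (- (x div int n)) * int n" for x
    by (simp add: minus_div_mult_eq_mod)
  have fixmod: "u (x mod int n) = x mod int n \<longleftrightarrow> u x = x" for x
    unfolding mod bracket_shift_mult[OF u n] by simp
  show "bij_betw (\<lambda>a. u a mod int n) ?A ?B"
    unfolding bij_betw_def
  proof (intro conjI inj_onI Set.set_eqI iffI)
    fix a b assume a: "a \<in> ?A" and b: "b \<in> ?A" and eq: "u a mod int n = u b mod int n"
    then have "int n dvd u a - u b" by (simp add: mod_eq_dvd_iff)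
    then obtain k where "u a - u b = int n * k" by (elim dvdE)
    then have k: "u a = u (b + k * int n)" by (simp add: bracket_shift_mult[OF u n] algebra_simps)
    have "opens n u a" "opens n u (b + k * int n)" using a b opens_shift[OF u n] by auto
    then have ab: "a = b + k * int n" using k unfolding opens_def by (metis linorder_neqE)
    then have "a mod int n = b mod int n" by simp
    then show "a = b" using a b by simp
  next
    fix y assume "y \<in> (\<lambda>a. u a mod int n) ` ?A"
    then obtain a where "y = u a mod int n" "u a < a + int n" by (auto simp: opens_def)
    then show "y \<in> ?B" using fixmod bracket_closed[OF u n] n by auto
  next
    fix y assume y: "y \<in> ?B"
    then obtain a where a: "opens n u a" "u a = y" 
      using fixed_iff_up_arc[OF u n, of y] by (auto simp: up_arcs_iff)
    have "u (a mod int n) mod int n = y mod int n"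
      unfolding mod[of a] bracket_shift_mult[OF u n] a(2) by (rule mod_mult_self1)
    moreover have "opens n u (a mod int n)" unfolding mod[of a] opens_shift[OF u n] by (rule a)
    ultimately show "y \<in> (\<lambda>a. u a mod int n) ` ?A" 
      using y n by (intro image_eqI[of _ _ "a mod int n"]) auto
  qed
qed

text \<open>The ones at even places number as many as the fixed points per period, and the ones at odd places
  are the remaining positions.\<close>

lemma word_in_words:
  assumes u: "bracket n u" and n: "n > 0"
  shows "word n u \<in> words n"
proof -
  have "word n u (j + 2 * int n) = word n u j" for j
  proof (cases "even j")
    case True
    then obtain i where j: "j = 2 * i" by (elim evenE)
    have "2 * i + 2 * int n = 2 * (i + int n)" by simp
    then show ?thesis using opens_shift[OF u n, of i 1] unfolding j by (simp only: word_even mult_1)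
  next
    case False
    then obtain i where j: "j = 2 * i + 1" by (elim oddE)
    have "2 * i + 1 + 2 * int n = 2 * (i + int n) + 1" by simp
    then show ?thesis using bracket_shift[OF u n, of i] unfolding j by (simp only: word_odd) simp
  qed
  moreover have "card {j \<in> {0..<2 * int n}. word n u j} = n"
  proof -
    have "card {i \<in> {0..<int n}. u i = i} + card {i \<in> {0..<int n}. i < u i}
      = card ({i \<in> {0..<int n}. u i = i} \<union> {i \<in> {0..<int n}. i < u i})"
    proof (rule card_Un_disjoint[symmetric])
      show "finite {i \<in> {0..<int n}. u i = i}" "finite {i \<in> {0..<int n}. i < u i}"
        by (rule finite_subset[of _ "{0..<int n}"], auto)+
    qed auto
    also have "{i \<in> {0..<int n}. u i = i} \<union> {i \<in> {0..<int n}. i < u i} = {0..<int n}"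
    proof -
      have "u i = i \<or> i < u i" for i using bracket_ge[OF u n, of i] by auto
      then show ?thesis by blast
    qed
    finally show ?thesis unfolding card_even_odd word_even word_odd card_opens[OF u n] by simp
  qed
  ultimately show ?thesis by (simp add: words_def)
qed

section \<open>Recovering the bracket vector from its word\<close>

text \<open>The height before step \<open>j\<close> of the lattice path with an up-step for each one and a down-step for
  each zero, starting from height \<open>0\<close> at \<open>0\<close>. One of the two sums is always empty.\<close>

definition height :: "(int \<Rightarrow> bool) \<Rightarrow> int \<Rightarrow> int" where
  "height w j = (\<Sum>i\<in>{0..<j}. if w i then 1 else -1) - (\<Sum>i\<in>{j..<0}. if w i then 1 else -1)"

lemma height_step: "height w (j + 1) = height w j + (if w j then 1 else -1)"
proof (cases "j \<ge> 0")
  case True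
  then have "{0..<j + 1} = insert j {0..<j}" by auto
  then show ?thesis using True by (simp add: height_def)
next
  case False
  then have "{j..<0} = insert j {j + 1..<0}" by auto
  then show ?thesis using False by (simp add: height_def)
qed

lemma even_height: "even (height w j) \<longleftrightarrow> even j"
proof (induction j rule: int_induct[where k = 0])
  case base show ?case by (simp add: height_def)
next
  case (step1 i) then show ?case by (simp add: height_step)
next
  case (step2 i) then show ?case using height_step[of w "i - 1"] by (auto split: if_splits)
qed

lemma height_periodic:
  assumes w: "w \<in> words n"
  shows "height w (j + 2 * int n) = height w j"
proof -
  have per: "w (j + 2 * int n) = w j" for j using w by (simp add: words_def)
  have card: "card {j \<in> {0..<2 * int n}. w j} = n" using w by (simp add: words_def)
  have 0: "height w (2 * int n) = 0"
  proof -
    have "(\<Sum>i\<in>{0..<2 * int n}. if w i then 1 else -1 :: int)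
       = (\<Sum>i\<in>{0..<2 * int n}. 2 * (if w i then 1 else 0) - 1)"
      by (intro sum.cong) auto
    also have "\<dots> = 2 * (\<Sum>i\<in>{0..<2 * int n}. if w i then 1 else 0) - 2 * int n"
      by (simp add: sum_subtractf sum_distrib_left)
    also have "(\<Sum>i\<in>{0..<2 * int n}. if w i then 1 else 0 :: int) = int n"
      using card by (simp flip: sum.inter_filter)
    finally show ?thesis by (simp add: height_def)
  qed
  show ?thesis
  proof (induction j rule: int_induct[where k = 0])
    case base show ?case using 0 by (simp add: height_def)
  next
    case (step1 i)
    then show ?case using height_step[of w "i + 2 * int n"] per[of i]
      height_step[of w i] by (simp add: algebra_simps)
  next
    case (step2 i)
    then show ?case using height_step[of w "i - 1 + 2 * int n"] height_step[of w "i - 1"] per[of "i - 1"]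
      by (simp add: algebra_simps)
  qed
qed

text \<open>The interval opened at \<open>x\<close>, just after step \<open>2x\<close>, lasts until the path drops below the height it
  has there; by parity the drop happens in a step \<open>2y + 1\<close>.\<close>

definition unword :: "nat \<Rightarrow> (int \<Rightarrow> bool) \<Rightarrow> int \<Rightarrow> int" where
  "unword n w x = Min (insert (x + int n)
     {y \<in> {x..<x + int n}. height w (2 * y + 2) < height w (2 * x + 1)})"

context
  fixes n :: nat and w :: "int \<Rightarrow> bool"
  assumes w: "w \<in> words n" and n: "n > 0"
begin

lemma height_shift: "height w (2 * (x + int n) + c) = height w (2 * x + c)"
  using height_periodic[OF w, of "2 * x + c"] by (simp add: algebra_simps)

lemma finite_drops: "finite {y \<in> {x..<x + int n}. height w (2 * y + 2) < height w (2 * x + 1)}"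
  by (rule finite_subset[of _ "{x..<x + int n}"]) auto

lemma unword_drop:
  assumes "unword n w x \<noteq> x + int n"
  shows "x \<le> unword n w x" "unword n w x < x + int n"
    "height w (2 * unword n w x + 2) < height w (2 * x + 1)"
  using Min_in[of "insert (x + int n)
     {y \<in> {x..<x + int n}. height w (2 * y + 2) < height w (2 * x + 1)}"] assms
    finite_drops[of x]
  unfolding unword_def[symmetric] by auto

lemma unword_bounds: "x \<le> unword n w x" "unword n w x \<le> x + int n"
  using unword_drop[of x] by (cases "unword n w x = x + int n"; simp)+

lemma unword_least:
  assumes "x \<le> y" "height w (2 * y + 2) < height w (2 * x + 1)"
  shows "unword n w x \<le> y"
proof (cases "y < x + int n")
  case True
  then show ?thesis unfolding unword_def using assms finite_drops[of x] by (intro Min_le) auto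
next
  case False
  then show ?thesis using unword_bounds(2)[of x] by simp
qed

text \<open>The path is periodic, so a drop can be moved into the first period.\<close>

lemma unword_finite:
  assumes "x \<le> y" "height w (2 * y + 2) < height w (2 * x + 1)"
  shows "unword n w x < x + int n"
  using assms
proof (induction "nat (y - x)" arbitrary: y rule: less_induct)
  case less
  show ?case
  proof (cases "y < x + int n")
    case True then show ?thesis using unword_least[OF less(2,3)] by simp
  next
    case False
    then show ?thesis
      using less(1)[of "y - int n"] less(2,3) height_shift[of "y - int n" 2] n by simp
  qed
qed

lemma unword_eqI:
  assumes "x \<le> y" "height w (2 * y + 2) < height w (2 * x + 1)"
    "\<And>z. x \<le> z \<Longrightarrow> z < y \<Longrightarrow> height w (2 * x + 1) \<le> height w (2 * z + 2)"
  shows "unword n w x = y"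
proof (rule antisym)
  show "unword n w x \<le> y" by (rule unword_least[OF assms(1,2)])
  show "y \<le> unword n w x"
    using unword_drop[of x] unword_finite[OF assms(1,2)] assms(3)[of "unword n w x"] by fastforce
qed

lemma unword_above: "x \<le> z \<Longrightarrow> z < unword n w x \<Longrightarrow> height w (2 * x + 1) \<le> height w (2 * z + 2)"
  using unword_least[of x z] by force

text \<open>Heights at odd and at even times have different parity.\<close>

lemma height_odd_even_le:
  "height w (2 * x + 1) \<le> height w (2 * z) \<longleftrightarrow> height w (2 * x + 1) < height w (2 * z)"
proof -
  have "height w (2 * x + 1) \<noteq> height w (2 * z)"
    using even_height[of w "2 * x + 1"] even_height[of w "2 * z"] by auto
  then show ?thesis by auto
qed

lemma unword_above_odd:
  assumes "x < y" "y \<le> unword n w x"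
  shows "height w (2 * x + 1) \<le> height w (2 * y + 1)" 
    "height w (2 * x + 1) < height w (2 * y)"
proof -
  show 1: "height w (2 * x + 1) < height w (2 * y)"
    using unword_above[of x "y - 1"] assms height_odd_even_le[of x y] by simp
  then show "height w (2 * x + 1) \<le> height w (2 * y + 1)"
    using height_step[of w "2 * y"] by (simp split: if_splits)
qed

lemma unword_bracket: "bracket n (unword n w)"
proof (rule bracketI)
  show "x \<le> unword n w x" "unword n w x \<le> x + int n" for x by (rule unword_bounds)+
  have inf: "unword n w (x + int n) = x + int n + int n" if "unword n w x = x + int n" for x
  proof (rule ccontr)
    let ?y = "unword n w (x + int n)"
    assume "?y \<noteq> x + int n + int n"
    then show False
      using unword_drop[of "x + int n"] unword_finite[of x "?y - int n"] that
        height_shift[of x 1] height_shift[of "?y - int n" 2] by simp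
  qed
  show "unword n w (x + int n) = unword n w x + int n" for x
  proof (cases "unword n w x = x + int n")
    case True then show ?thesis using inf by simp
  next
    case False
    show ?thesis
    proof (rule unword_eqI)
      show "x + int n \<le> unword n w x + int n" using unword_bounds[of x] by simp
      show "height w (2 * (unword n w x + int n) + 2) < height w (2 * (x + int n) + 1)"
        unfolding height_shift by (rule unword_drop[OF False])
      fix z assume "x + int n \<le> z" "z < unword n w x + int n"
      then show "height w (2 * (x + int n) + 1) \<le> height w (2 * z + 2)"
        using unword_above[of x "z - int n"] height_shift[of x 1] height_shift[of "z - int n" 2] by simp
    qed
  qed
  show "unword n w y \<le> unword n w x" 
    if "unword n w x < x + int n" "x < y" "y \<le> unword n w x" for x y
    using unword_least[of y "unword n w x"] unword_drop[of x] unword_above_odd(1)[of x y] that by simp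
qed

lemma word_unword_odd: "i < unword n w i \<longleftrightarrow> w (2 * i + 1)"
proof -
  have "unword n w i = i \<longleftrightarrow> height w (2 * i + 2) < height w (2 * i + 1)"
  proof
    assume "unword n w i = i"
    then show "height w (2 * i + 2) < height w (2 * i + 1)" using unword_drop(3)[of i] n by simp
  qed (auto intro: unword_eqI)
  also have "\<dots> \<longleftrightarrow> \<not> w (2 * i + 1)" using height_step[of w "2 * i + 1"] by (simp add: add.assoc)
  finally show ?thesis using unword_bounds(1)[of i] by auto
qed

text \<open>If step \<open>2i\<close> goes up, the path is at least two units higher after it than when any interval
  still open at \<open>i\<close> was opened, so the first drop below its new height does not end those intervals.
  If it goes down, the last earlier odd time at which the path was not above its new height has
  exactly this height, and the interval opened there closes together with that of \<open>i\<close>.\<close>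

lemma word_unword_even: "opens n (unword n w) i \<longleftrightarrow> w (2 * i)"
proof (cases "w (2 * i)")
  case True
  have up: "height w (2 * i + 1) = height w (2 * i) + 1" using True by (simp add: height_step)
  have "height w (2 * (i + int n - 1) + 2) < height w (2 * i + 1)"
    using height_shift[of i 0] up by (simp add: algebra_simps)
  then have fin: "unword n w i < i + int n" using unword_finite[of i "i + int n - 1"] n by simp
  let ?y = "unword n w i"
  have "unword n w b \<noteq> ?y" if b: "b < i" for b
  proof
    assume eq: "unword n w b = ?y"
    have "height w (2 * b + 1) < height w (2 * i)"
      using unword_above_odd(2)[OF b] unword_bounds(1)[of i] eq by simp
    then have *: "height w (2 * b + 1) + 2 \<le> height w (2 * i + 1)" using up by simp
    have "height w (2 * b + 1) < height w (2 * ?y + 1)"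
    proof (cases "?y = i")
      case True then show ?thesis using * by simp
    next
      case False
      then show ?thesis
        using unword_above_odd(1)[of i ?y] unword_bounds(1)[of i] * by simp
    qed
    moreover have "height w (2 * ?y + 1) \<le> height w (2 * ?y + 2) + 1"
      using height_step[of w "2 * ?y + 1"] by (simp add: add.assoc split: if_splits)
    ultimately have "height w (2 * b + 1) \<le> height w (2 * ?y + 2)" by simp
    moreover have "unword n w b < b + int n"
      using bracket_value_finite[OF unword_bracket n fin eq] .
    ultimately show False using unword_drop(3)[of b] eq by simp
  qed
  then show ?thesis using fin True by (simp add: opens_def)
next
  case False
  have down: "height w (2 * i + 1) = height w (2 * i) - 1" using False by (simp add: height_step)
  show ?thesis
  proof (cases "unword n w i = i + int n")
    case True then show ?thesis using False by (simp add: opens_def)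
  next
    case fin: False
    \<comment> \<open>Search backwards from \<open>i\<close>; going back a full period certainly succeeds.\<close>
    define P where "P k \<longleftrightarrow> 0 < k \<and> height w (2 * (i - int k) + 1) \<le> height w (2 * i + 1)" for k
    have "P n" using n height_shift[of "i - int n" 1] by (simp add: P_def)
    then obtain k where k: "P k" "\<And>j. j < k \<Longrightarrow> \<not> P j" by (metis LeastI not_less_Least)
    define b where "b = i - int k"
    have b: "b < i" "height w (2 * b + 1) \<le> height w (2 * i + 1)" using k(1) by (auto simp: P_def b_def)
    have above: "height w (2 * i + 1) < height w (2 * z + 2)" if z: "b \<le> z" "z < i" for z
    proof (cases "z + 1 = i")
      case True then show ?thesis using down by (auto simp: distrib_left)
    next
      case False
      then have "nat (i - (z + 1)) < k" "0 < nat (i - (z + 1))" using z by (auto simp: b_def)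
      then have "height w (2 * i + 1) < height w (2 * (z + 1) + 1)" 
        using k(2)[of "nat (i - (z + 1))"] by (simp add: P_def)
      then show ?thesis
        using height_step[of w "2 * z + 2"] height_odd_even_le[of i "z + 1"]
        by (simp add: distrib_left add.assoc split: if_splits)
    qed
    have "height w (2 * b + 1) = height w (2 * i + 1)"
      using b above[of b] height_step[of w "2 * b + 1"] by (simp add: add.assoc split: if_splits)
    then have "unword n w b = unword n w i"
    proof (intro unword_eqI)
      show "b \<le> unword n w i" using b unword_bounds(1)[of i] by simp
      assume eq: "height w (2 * b + 1) = height w (2 * i + 1)"
      then show "height w (2 * unword n w i + 2) < height w (2 * b + 1)" using unword_drop(3)[OF fin] by simp
      fix z assume "b \<le> z" "z < unword n w i"
      then show "height w (2 * b + 1) \<le> height w (2 * z + 2)"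
        using eq above[of z] unword_above[of i z] by (cases "z < i") auto
    qed
    then show ?thesis using b False by (auto simp: opens_def)
  qed
qed

theorem word_unword: "word n (unword n w) = w"
proof
  fix j show "word n (unword n w) j = w j"
  proof (cases "even j")
    case True
    then obtain i where "j = 2 * i" by (elim evenE)
    then show ?thesis using word_unword_even by simp
  next
    case False
    then obtain i where "j = 2 * i + 1" by (elim oddE)
    then show ?thesis using word_unword_odd by simp
  qed
qed

end

theorem bij_word: "n > 0 \<Longrightarrow> bij_betw (word n) {u. bracket n u} (words n)"
  unfolding bij_betw_def
  by (auto intro!: inj_onI simp: word_in_words intro: word_inj)
     (metis (mono_tags) imageI mem_Collect_eq unword_bracket word_unword)

section \<open>Bracket vectors of 312-avoiding orders\<close>

definition bracket_of :: "nat \<Rightarrow> int rel \<Rightarrow> int \<Rightarrow> int" where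
  "bracket_of n r x = Max {y \<in> {x..x + int n}. (y, x) \<in> r}"

text \<open>Meant for \<open>x \<le> y\<close>: the larger element \<open>y\<close> comes weakly before \<open>x\<close> in the order.\<close>

definition precedes :: "nat \<Rightarrow> (int \<Rightarrow> int) \<Rightarrow> int \<Rightarrow> int \<Rightarrow> bool" where
  "precedes n u x y \<longleftrightarrow> y \<le> u x \<or> u x = x + int n"

definition tito_of :: "nat \<Rightarrow> (int \<Rightarrow> int) \<Rightarrow> int rel" where
  "tito_of n u = {(y, x). if x \<le> y then precedes n u x y else \<not> precedes n u y x}"

lemma carrier_CTam: "r \<in> carrier (CTam n) \<longleftrightarrow> tito n r \<and> avoids_312 r"
  by (simp add: CTam_def)

lemma tito_shift:
  assumes "tito n r"
  shows "(a + k * int n, b + k * int n) \<in> r \<longleftrightarrow> (a, b) \<in> r"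
proof -
  have step: "(a + int n, b + int n) \<in> r \<longleftrightarrow> (a, b) \<in> r" for a b
    using assms by (simp add: tito_def)
  have nat: "(a + int m * int n, b + int m * int n) \<in> r \<longleftrightarrow> (a, b) \<in> r" for a b m
  proof (induction m)
    case (Suc m)
    then show ?case using step[of "a + int m * int n" "b + int m * int n"] by (simp add: algebra_simps)
  qed simp
  show ?thesis
  proof (cases "k \<ge> 0")
    case True then show ?thesis using nat[of a "nat k" b] by simp
  next
    case False then show ?thesis using nat[of "a + k * int n" "nat (-k)" "b + k * int n"] by simp
  qed
qed

context
  fixes n :: nat and r :: "int rel"
  assumes r: "r \<in> carrier (CTam n)" and n: "n > 0"
begin

lemma tito: "tito n r" using r by (simp add: carrier_CTam)

lemma tito_order:
  "(x, x) \<in> r" "(x, y) \<in> r \<Longrightarrow> (y, z) \<in> r \<Longrightarrow> (x, z) \<in> r"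
  "(x, y) \<in> r \<Longrightarrow> (y, x) \<in> r \<Longrightarrow> x = y" "(x, y) \<in> r \<or> (y, x) \<in> r"
proof -
  have L: "refl r" "trans r" "antisym r" "total r"
    using tito unfolding tito_def linear_order_on_def partial_order_on_def preorder_on_def by simp_all
  show "(x, x) \<in> r" for x using L(1) by (rule reflD)
  then show "(x, y) \<in> r \<or> (y, x) \<in> r" using L(4) by (cases "x = y") (auto simp: total_on_def)
  show "(x, y) \<in> r \<Longrightarrow> (y, z) \<in> r \<Longrightarrow> (x, z) \<in> r" using L(2) by (rule transD)
  show "(x, y) \<in> r \<Longrightarrow> (y, x) \<in> r \<Longrightarrow> x = y" using L(3) by (rule antisymD)
qed

text \<open>This is where 312-avoidance enters: \<open>z\<close>, \<open>x\<close>, \<open>y\<close> in this order would form the pattern.\<close>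

lemma tito_interval: "(z, x) \<in> r \<Longrightarrow> x \<le> y \<Longrightarrow> y \<le> z \<Longrightarrow> (y, x) \<in> r"
proof -
  assume zx: "(z, x) \<in> r" and "x \<le> y" "y \<le> z"
  then consider "y = x" | "y = z" | "x < y" "y < z" by linarith
  then show "(y, x) \<in> r"
  proof cases
    case 1 then show ?thesis by (simp only: tito_order(1))
  next
    case 2 then show ?thesis using zx by (simp only:)
  next
    case 3
    then have "(x, y) \<notin> r" using r zx unfolding carrier_CTam avoids_312_def by blast
    then show ?thesis using tito_order(4) by blast
  qed
qed

lemma bracket_of_in: "x \<le> bracket_of n r x" "bracket_of n r x \<le> x + int n" "(bracket_of n r x, x) \<in> r"
proof -
  have "finite {y \<in> {x..x + int n}. (y, x) \<in> r}" by (rule finite_subset[of _ "{x..x + int n}"]) auto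
  moreover have "x \<in> {y \<in> {x..x + int n}. (y, x) \<in> r}" using tito_order(1) by simp
  ultimately have "bracket_of n r x \<in> {y \<in> {x..x + int n}. (y, x) \<in> r}"
    unfolding bracket_of_def using Max_in by blast
  then show "x \<le> bracket_of n r x" "bracket_of n r x \<le> x + int n" "(bracket_of n r x, x) \<in> r" by auto
qed

lemma bracket_of_ge:
  assumes "(y, x) \<in> r" "x \<le> y" "y \<le> x + int n" shows "y \<le> bracket_of n r x"
proof -
  have "finite {y \<in> {x..x + int n}. (y, x) \<in> r}" by (rule finite_subset[of _ "{x..x + int n}"]) auto
  then show ?thesis using assms unfolding bracket_of_def by (intro Max_ge) auto
qed

text \<open>An element preceding \<open>x\<close> from beyond \<open>x + n\<close> forces \<open>x + n\<close> itself to precede \<open>x\<close>, and then so do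
  all \<open>x + m n\<close> by translation, and everything in between. This justifies cutting off at \<open>x + n\<close>.\<close>

lemma tito_iff_precedes:
  assumes "x \<le> y" shows "(y, x) \<in> r \<longleftrightarrow> precedes n (bracket_of n r) x y"
proof
  assume yx: "(y, x) \<in> r"
  show "precedes n (bracket_of n r) x y"
  proof (cases "y \<le> x + int n")
    case True then show ?thesis using bracket_of_ge yx assms by (simp add: precedes_def)
  next
    case False
    then have "(x + int n, x) \<in> r" using tito_interval[OF yx] by simp
    then show ?thesis using bracket_of_ge[of "x + int n" x] bracket_of_in(2)[of x] by (simp add: precedes_def)
  qed
next
  assume "precedes n (bracket_of n r) x y"
  then consider "y \<le> bracket_of n r x" | "bracket_of n r x = x + int n" by (auto simp: precedes_def)
  then show "(y, x) \<in> r"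
  proof cases
    case 1 then show ?thesis using tito_interval[OF bracket_of_in(3)] assms by blast
  next
    case 2
    have "(x + int m * int n, x) \<in> r" for m
    proof (induction m)
      case (Suc m)
      have "(x + int n, x) \<in> r" using bracket_of_in(3)[of x] 2 by simp
      then have "(x + int n + int m * int n, x + int m * int n) \<in> r" using tito_shift[OF tito] by simp
      then show ?case using tito_order(2) Suc by (simp add: algebra_simps)
    qed (simp add: tito_order)
    moreover have "y \<le> x + int (nat (y - x)) * int n" 
    proof -
      have "(y - x) * 1 \<le> (y - x) * int n" using assms n by (intro mult_left_mono) auto
      then show ?thesis using assms by simp
    qed
    ultimately show ?thesis using tito_interval assms by blast
  qed
qed

lemma bracket_bracket_of: "bracket n (bracket_of n r)"
proof (rule bracketI)
  show "x \<le> bracket_of n r x" "bracket_of n r x \<le> x + int n" for x by (rule bracket_of_in)+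
  show "bracket_of n r (x + int n) = bracket_of n r x + int n" for x
  proof (rule antisym)
    show "bracket_of n r (x + int n) \<le> bracket_of n r x + int n"
      using bracket_of_in[of "x + int n"] bracket_of_ge[of "bracket_of n r (x + int n) - int n" x]
        tito_shift[OF tito, of "bracket_of n r (x + int n)" "-1" "x + int n"] by simp
    show "bracket_of n r x + int n \<le> bracket_of n r (x + int n)"
      using bracket_of_in[of x] bracket_of_ge[of "bracket_of n r x + int n" "x + int n"]
        tito_shift[OF tito, of "bracket_of n r x" 1 x] by simp
  qed
  show "bracket_of n r y \<le> bracket_of n r x"
    if "bracket_of n r x < x + int n" "x < y" "y \<le> bracket_of n r x" for x y
  proof -
    have "(y, x) \<in> r" using tito_iff_precedes[of x y] that by (simp add: precedes_def)
    then have "(bracket_of n r y, x) \<in> r" using bracket_of_in(3)[of y] tito_order(2) by blast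
    then show ?thesis using tito_iff_precedes[of x "bracket_of n r y"] bracket_of_in(1)[of y] that
      by (simp add: precedes_def)
  qed
qed

lemma tito_of_bracket_of: "tito_of n (bracket_of n r) = r"
proof -
  have "(y, x) \<in> tito_of n (bracket_of n r) \<longleftrightarrow> (y, x) \<in> r" for y x
  proof (cases "x \<le> y")
    case True then show ?thesis using tito_iff_precedes by (simp add: tito_of_def)
  next
    case False
    then have "(y, x) \<in> r \<longleftrightarrow> (x, y) \<notin> r" using tito_order(3,4) by blast
    then show ?thesis using tito_iff_precedes[of y x] False by (simp add: tito_of_def)
  qed
  then show ?thesis by auto
qed

end

context
  fixes n :: nat and u :: "int \<Rightarrow> int"
  assumes u: "bracket n u" and n: "n > 0"
begin

lemma precedes_refl: "precedes n u x x"
  using bracket_ge[OF u n, of x] by (simp add: precedes_def)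

lemma precedes_interval: "precedes n u x z \<Longrightarrow> y \<le> z \<Longrightarrow> precedes n u x y"
  by (auto simp: precedes_def)

lemma precedes_trans:
  assumes "x \<le> y" "precedes n u x y" "precedes n u y z"
  shows "precedes n u x z"
proof (cases "u x = x + int n")
  case True then show ?thesis by (simp add: precedes_def)
next
  case False
  then have fin: "u x < x + int n" using bracket_le[OF u n, of x] by simp
  then have "u y \<le> u x" using bracket_nested[OF u n fin assms(1)] assms(2) by (simp add: precedes_def)
  then show ?thesis using assms fin by (auto simp: precedes_def)
qed

text \<open>The inversions of an order obtained from a bracket vector are transitive because the intervals
  are nested; so are the non-inversions, because the intervals have no gaps. Combining the two
  gives transitivity in the mixed cases.\<close>

lemma tito_of_carrier: "tito_of n u \<in> carrier (CTam n)"
proof -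
  have "trans (tito_of n u)"
  proof (rule transI)
    fix a b c assume ab: "(a, b) \<in> tito_of n u" and bc: "(b, c) \<in> tito_of n u"
    show "(a, c) \<in> tito_of n u"
    proof (cases "b \<le> a"; cases "c \<le> b")
      assume "b \<le> a" "c \<le> b"
      then show ?thesis using ab bc precedes_trans[of c b a] by (simp add: tito_of_def)
    next
      assume *: "b \<le> a" "\<not> c \<le> b"
      then have 1: "precedes n u b a" "\<not> precedes n u b c" using ab bc by (simp_all add: tito_of_def)
      then have "\<not> c \<le> a" using precedes_interval[of b a c] by blast
      moreover have "\<not> precedes n u a c" using 1 precedes_trans[of b a c] * by blast
      ultimately show ?thesis by (simp add: tito_of_def)
    next
      assume *: "\<not> b \<le> a" "c \<le> b"
      then have 1: "\<not> precedes n u a b" "precedes n u c b" using ab bc by (simp_all add: tito_of_def)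
      show ?thesis 
      proof (cases "c \<le> a")
        case True
        then show ?thesis using 1 precedes_interval[of c b a] * by (simp add: tito_of_def)
      next
        case False
        then have "\<not> precedes n u a c" using 1 precedes_trans[of a c b] by auto
        then show ?thesis using False by (simp add: tito_of_def)
      qed
    next
      assume *: "\<not> b \<le> a" "\<not> c \<le> b"
      then have "\<not> precedes n u a b" using ab by (simp add: tito_of_def)
      then have "\<not> precedes n u a c" using * precedes_interval[of a c b] by auto
      then show ?thesis using * by (simp add: tito_of_def)
    qed
  qed
  moreover have "refl (tito_of n u)" by (simp add: refl_on_def tito_of_def precedes_refl)
  moreover have "antisym (tito_of n u)" "total (tito_of n u)"
    by (auto simp: antisym_def total_on_def tito_of_def split: if_splits)
  ultimately have "linear_order_on UNIV (tito_of n u)"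
    by (simp add: linear_order_on_def partial_order_on_def preorder_on_def)
  moreover have "(a, b) \<in> tito_of n u \<longleftrightarrow> (a + int n, b + int n) \<in> tito_of n u" for a b
    unfolding tito_of_def precedes_def mem_Collect_eq case_prod_conv bracket_shift[OF u n] by auto
  moreover have "avoids_312 (tito_of n u)"
    unfolding avoids_312_def
  proof clarify
    fix a b c :: int assume "a < b" "b < c" "(c, a) \<in> tito_of n u" "(a, b) \<in> tito_of n u"
    then show False using precedes_interval[of a c b] by (simp add: tito_of_def)
  qed
  ultimately show ?thesis by (simp add: carrier_CTam tito_def)
qed

lemma bracket_of_tito_of: "bracket_of n (tito_of n u) = u"
proof
  fix x
  have "(u x, x) \<in> tito_of n u" using bracket_ge[OF u n, of x] by (simp add: tito_of_def precedes_def)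
  then have "u x \<le> bracket_of n (tito_of n u) x"
    using bracket_of_ge[OF tito_of_carrier n] bracket_ge[OF u n] bracket_le[OF u n] by blast
  moreover have "precedes n u x (bracket_of n (tito_of n u) x)"
    using bracket_of_in[OF tito_of_carrier n, of x] by (simp add: tito_of_def)
  then have "bracket_of n (tito_of n u) x \<le> u x"
    using bracket_of_in(2)[OF tito_of_carrier n, of x] by (auto simp: precedes_def)
  ultimately show "bracket_of n (tito_of n u) x = u x" by simp
qed

end

lemma bij_bracket_of:
  assumes n: "n > 0" 
  shows "bij_betw (bracket_of n) (carrier (CTam n)) {u. bracket n u}"
  using n by (intro bij_betw_byWitness[where f' = "tito_of n"])
    (auto simp: tito_of_bracket_of bracket_of_tito_of bracket_bracket_of tito_of_carrier)

lemma inversion_set_subset_iff: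
  assumes "tito n r" "tito n s"
  shows "inversion_set n r \<subseteq> inversion_set n s \<longleftrightarrow> (\<forall>a b. a < b \<longrightarrow> (b, a) \<in> r \<longrightarrow> (b, a) \<in> s)"
proof
  assume sub: "inversion_set n r \<subseteq> inversion_set n s"
  show "\<forall>a b. a < b \<longrightarrow> (b, a) \<in> r \<longrightarrow> (b, a) \<in> s"
  proof (intro allI impI)
    fix a b :: int assume ab: "a < b" "(b, a) \<in> r"
    then have "translation_class n a b \<in> inversion_set n r" unfolding inversion_set_def by blast
    then have "translation_class n a b \<in> inversion_set n s" using sub by blast
    then obtain c d where cd: "translation_class n a b = translation_class n c d" "(d, c) \<in> s"
      unfolding inversion_set_def by blast
    have "(a, b) \<in> translation_class n a b" unfolding translation_class_def
      by (rule CollectI, rule exI[of _ 0]) simp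
    then obtain k where "a = c + k * int n" "b = d + k * int n" 
      unfolding cd(1) by (auto simp: translation_class_def)
    then show "(b, a) \<in> s" using cd(2) tito_shift[OF assms(2)] by simp
  qed
next
  assume "\<forall>a b. a < b \<longrightarrow> (b, a) \<in> r \<longrightarrow> (b, a) \<in> s"
  then show "inversion_set n r \<subseteq> inversion_set n s" unfolding inversion_set_def by blast
qed

lemma CTam_le_iff:
  assumes r: "r \<in> carrier (CTam n)" and s: "s \<in> carrier (CTam n)" and n: "n > 0"
  shows "r \<sqsubseteq>\<^bsub>CTam n\<^esub> s \<longleftrightarrow> (\<forall>x. bracket_of n r x \<le> bracket_of n s x)"
proof -
  have "r \<sqsubseteq>\<^bsub>CTam n\<^esub> s \<longleftrightarrow> (\<forall>a b. a < b \<longrightarrow> (b, a) \<in> r \<longrightarrow> (b, a) \<in> s)"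
    using inversion_set_subset_iff[of n r s] r s by (simp add: CTam_def)
  also have "\<dots> \<longleftrightarrow> (\<forall>x. bracket_of n r x \<le> bracket_of n s x)"
  proof (intro iffI allI impI)
    fix x assume *: "\<forall>a b. a < b \<longrightarrow> (b, a) \<in> r \<longrightarrow> (b, a) \<in> s"
    show "bracket_of n r x \<le> bracket_of n s x"
    proof (cases "bracket_of n r x = x")
      case True then show ?thesis using bracket_of_in(1)[OF s n, of x] by simp
    next
      case False
      then have "(bracket_of n r x, x) \<in> s" using * bracket_of_in[OF r n, of x] by simp
      then show ?thesis using bracket_of_ge[OF s n] bracket_of_in[OF r n] by blast
    qed
  next
    fix a b :: int assume le: "\<forall>x. bracket_of n r x \<le> bracket_of n s x" and ab: "a < b" "(b, a) \<in> r"
    have "precedes n (bracket_of n r) a b" using tito_iff_precedes[OF r n, of a b] ab by simp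
    moreover have "bracket_of n r a \<le> bracket_of n s a" using le by blast
    ultimately have "precedes n (bracket_of n s) a b"
      using bracket_of_in(2)[OF s n, of a] unfolding precedes_def by linarith
    then show "(b, a) \<in> s" using tito_iff_precedes[OF s n, of a b] ab by simp
  qed
  finally show ?thesis .
qed

section \<open>Covers among bracket vectors\<close>

text \<open>Bracket vectors are closed under pointwise minima, which gives both meets and, as minima of
  upper bounds, joins.\<close>

lemma bracket_Min:
  assumes n: "n > 0" and G: "\<And>g. g \<in> G \<Longrightarrow> bracket n g" and ne: "G \<noteq> {}"
  shows "bracket n (\<lambda>x. Min ((\<lambda>g. g x) ` G))" 
    and "\<And>g. g \<in> G \<Longrightarrow> (\<lambda>x. Min ((\<lambda>g. g x) ` G)) \<le> g"
    and "\<And>x. \<exists>g\<in>G. Min ((\<lambda>g. g x) ` G) = g x"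
proof -
  let ?m = "\<lambda>x. Min ((\<lambda>g. g x) ` G)"
  have fin: "finite ((\<lambda>g. g x) ` G)" for x
  proof (rule finite_subset)
    show "(\<lambda>g. g x) ` G \<subseteq> {x..x + int n}" using bracket_ge bracket_le G n by fastforce
  qed simp
  show le: "?m \<le> g" if "g \<in> G" for g
    using fin that by (auto simp: le_fun_def)
  show ex: "\<exists>g\<in>G. ?m x = g x" for x
    using Min_in[OF fin[of x]] ne by auto
  show "bracket n ?m"
  proof (rule bracketI)
    fix x
    obtain g where g: "g \<in> G" "?m x = g x" using ex by blast
    obtain g' where g': "g' \<in> G" "?m (x + int n) = g' (x + int n)" using ex by blast
    show "x \<le> ?m x" "?m x \<le> x + int n" using g bracket_ge[OF G n] bracket_le[OF G n] by simp_all
    show "?m (x + int n) = ?m x + int n"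
      using g g' le_funD[OF le[OF g(1)], of "x + int n"] le_funD[OF le[OF g'(1)], of x] 
        bracket_shift[OF G n, of g x] bracket_shift[OF G n, of g' x] by simp
    fix y assume "?m x < x + int n" "x < y" "y \<le> ?m x"
    then show "?m y \<le> ?m x"
      using g le_funD[OF le[OF g(1)], of y] bracket_nested[OF G n, of g x y] by simp
  qed
qed

text \<open>Replaces the value at \<open>a\<close> by \<open>c\<close>, and correspondingly on the residue class of \<open>a\<close>.\<close>

definition set_class :: "nat \<Rightarrow> (int \<Rightarrow> int) \<Rightarrow> int \<Rightarrow> int \<Rightarrow> int \<Rightarrow> int" where
  "set_class n u a c x = (if int n dvd x - a then c + (x - a) else u x)"

lemma set_class_at [simp]: "set_class n u a c a = c" by (simp add: set_class_def)

lemma set_class_off: "\<not> int n dvd x - a \<Longrightarrow> set_class n u a c x = u x" by (simp add: set_class_def)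

lemma set_class_shift: "set_class n u (a + k * int n) (c + k * int n) = set_class n u a c"
  by (auto simp: set_class_def fun_eq_iff dvd_diff_commute algebra_simps
      dvd_add_left_iff[of "int n" "k * int n"] simp flip: add_diff_eq diff_diff_eq)

lemma not_dvd_between: "a < x \<Longrightarrow> x < a + int n \<Longrightarrow> \<not> int n dvd x - a"
  using zdvd_not_zless[of "x - a" "int n"] by simp

lemma bracket_class:
  assumes u: "bracket n u" and n: "n > 0" and "int n dvd x - a"
  shows "u x = u a + (x - a)"
proof -
  obtain k where "x - a = int n * k" using assms(3) by (elim dvdE)
  then show ?thesis using bracket_shift_mult[OF u n, of a k] by (simp add: algebra_simps)
qed

text \<open>A translation-invariant condition on the values along a residue class has to be checked at one
  representative only.\<close>

lemma all_class_iff: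
  assumes u: "bracket n u" and n: "n > 0" and P: "\<And>y d. P (y + d) (c + d) \<longleftrightarrow> P y c"
  shows "(\<forall>x. int n dvd x - a \<longrightarrow> P (u x) (c + (x - a))) \<longleftrightarrow> P (u a) c"
  using bracket_class[OF u n] P by (metis add.right_neutral cancel_comm_monoid_add_class.diff_cancel dvd_0_right)

lemma le_set_class_iff:
  assumes u: "bracket n u" and n: "n > 0" 
  shows "u \<le> set_class n v a c \<longleftrightarrow> u a \<le> c \<and> (\<forall>x. \<not> int n dvd x - a \<longrightarrow> u x \<le> v x)"
proof -
  have "u \<le> set_class n v a c \<longleftrightarrow> (\<forall>x. int n dvd x - a \<longrightarrow> u x \<le> c + (x - a)) \<and>
      (\<forall>x. \<not> int n dvd x - a \<longrightarrow> u x \<le> v x)"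
    by (auto simp: le_fun_def set_class_def)
  then show ?thesis using all_class_iff[OF u n, of "(\<le>)" c a] by simp
qed

lemma set_class_le_iff:
  assumes u: "bracket n u" and n: "n > 0" 
  shows "set_class n v a c \<le> u \<longleftrightarrow> c \<le> u a \<and> (\<forall>x. \<not> int n dvd x - a \<longrightarrow> v x \<le> u x)"
proof -
  have "set_class n v a c \<le> u \<longleftrightarrow> (\<forall>x. int n dvd x - a \<longrightarrow> c + (x - a) \<le> u x) \<and>
      (\<forall>x. \<not> int n dvd x - a \<longrightarrow> v x \<le> u x)"
    by (auto simp: le_fun_def set_class_def)
  then show ?thesis using all_class_iff[OF u n, of "(\<ge>)" c a] by simp
qed

lemma eq_set_class_iff:
  assumes u: "bracket n u" and n: "n > 0" 
  shows "u = set_class n v a c \<longleftrightarrow> u a = c \<and> (\<forall>x. \<not> int n dvd x - a \<longrightarrow> u x = v x)"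
proof -
  have "u = set_class n v a c \<longleftrightarrow> (\<forall>x. int n dvd x - a \<longrightarrow> u x = c + (x - a)) \<and>
      (\<forall>x. \<not> int n dvd x - a \<longrightarrow> u x = v x)"
    by (auto simp: fun_eq_iff set_class_def)
  then show ?thesis using all_class_iff[OF u n, of "(=)" c a] by simp
qed

lemma set_class_self: "bracket n u \<Longrightarrow> n > 0 \<Longrightarrow> set_class n u a (u a) = u"
  using eq_set_class_iff[of n u u a "u a"] by simp

text \<open>The new interval \<open>[a, c]\<close> must contain the intervals that start inside it and be contained in the
  finite ones that start before \<open>a\<close> and reach \<open>a\<close>.\<close>

lemma bracket_set_class:
  assumes u: "bracket n u" and n: "n > 0" and c: "a \<le> c" "c \<le> a + int n"
    and inside: "\<And>z. c < a + int n \<Longrightarrow> a < z \<Longrightarrow> z \<le> c \<Longrightarrow> u z \<le> c"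
    and outside: "\<And>x. x < a \<Longrightarrow> a \<le> u x \<Longrightarrow> u x < x + int n \<Longrightarrow> c \<le> u x"
  shows "bracket n (set_class n u a c)"
proof (rule bracketI)
  let ?v = "set_class n u a c"
  show "x \<le> ?v x" "?v x \<le> x + int n" for x
    using c bracket_ge[OF u n, of x] bracket_le[OF u n, of x] by (auto simp: set_class_def)
  show "?v (x + int n) = ?v x + int n" for x
  proof -
    have "int n dvd x + int n - a \<longleftrightarrow> int n dvd x - a"
      by (metis add_diff_eq add.commute dvd_add_triv_right_iff diff_add_eq)
    then show ?thesis using bracket_shift[OF u n, of x] by (simp add: set_class_def)
  qed
  fix x z assume x: "?v x < x + int n" and z: "x < z" "z \<le> ?v x"
  show "?v z \<le> ?v x"
  proof (cases "int n dvd x - a")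
    case True
    then have vx: "?v x = c + (x - a)" by (simp add: set_class_def)
    let ?z = "z - (x - a)"
    have zn: "\<not> int n dvd z - x" using not_dvd_between[of x z n] x z by simp
    then have za: "\<not> int n dvd z - a" using True dvd_diff[of "int n" "z - a" "x - a"] by auto
    have "int n dvd z - ?z" using True by simp
    then have "u z = u ?z + (x - a)" using bracket_class[OF u n, of z ?z] by simp
    moreover have "u ?z \<le> c" using inside[of ?z] x z vx by simp
    ultimately show ?thesis using vx za by (simp add: set_class_def)
  next
    case False
    then have vx: "?v x = u x" by (simp add: set_class_def)
    show ?thesis
    proof (cases "int n dvd z - a")
      case True
      then have vz: "?v z = c + (z - a)" by (simp add: set_class_def)
      have "int n dvd (x - (z - a)) - x" using True by (simp add: dvd_diff_commute)
      then have "u (x - (z - a)) = u x - (z - a)" using bracket_class[OF u n, of "x - (z - a)" x] by simp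
      then have "c \<le> u x - (z - a)" using outside[of "x - (z - a)"] z x vx by simp
      then show ?thesis using vx vz by simp
    next
      case False
      then show ?thesis using vx z x bracket_nested[OF u n, of x z] by (simp add: set_class_def)
    qed
  qed
qed

context
  fixes n :: nat and u :: "int \<Rightarrow> int"
  assumes u: "bracket n u" and n: "n > 0"
begin

text \<open>The largest value below \<open>u a\<close> that is possible at \<open>a\<close> is \<open>e - 1\<close>: everything between \<open>a\<close> and \<open>e\<close>
  closes before \<open>e\<close>, while an interval reaching \<open>e\<close> has to contain that of \<open>e\<close> and thus reach
  \<open>u a\<close>.\<close>

lemma bracket_lowered:
  assumes ae: "(a, e) \<in> down_arcs n u"
  shows "bracket n (set_class n u a (e - 1))"
proof (rule bracket_set_class[OF u n])
  show "a \<le> e - 1" "e - 1 \<le> a + int n"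
    using down_arc_lt[OF ae] down_arc_left(3)[OF u n ae] by auto
  show "u z \<le> e - 1" if "a < z" "z \<le> e - 1" for z
    using down_arc_inside(1)[OF u n ae, of z] that by simp
  show "e - 1 \<le> u x" if "x < a" "a \<le> u x" "u x < x + int n" for x
    using bracket_nested[OF u n, of x a] that down_arc_left(2)[OF u n ae] by simp
qed

lemma down_arc_right_value:
  assumes ae: "(a, e) \<in> down_arcs n u" and g: "bracket n g" and "e \<le> g a" "g e = u e"
  shows "u a \<le> g a"
proof (rule ccontr)
  assume "\<not> u a \<le> g a"
  then have lt: "g a < u a" by simp
  then have "g e \<le> g a"
    using bracket_nested[OF g n, of a e] bracket_le[OF u n, of a] down_arc_lt[OF ae] assms by simp
  then show False using lt ae assms(4) bracket_le[OF g n, of a] down_arc_lt[OF ae]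
    by (auto simp: down_arcs_def same_closing_def split: if_splits)
qed

lemma between_lowered:
  assumes ae: "(a, e) \<in> down_arcs n u" and g: "bracket n g"
    and le: "set_class n u a (e - 1) \<le> g" "g \<le> u"
  shows "g = set_class n u a (e - 1) \<or> g = u"
proof -
  have off: "g x = u x" if "\<not> int n dvd x - a" for x
    using le that set_class_le_iff[OF g n, of u a "e - 1"] le_funD[OF le(2), of x] by force
  have "e - 1 \<le> g a" using le set_class_le_iff[OF g n, of u a "e - 1"] by simp
  then consider "g a = e - 1" | "e \<le> g a" by linarith
  then show ?thesis
  proof cases
    case 1 then show ?thesis using off eq_set_class_iff[OF g n] by blast
  next
    case 2
    have "u a \<le> g a"
    proof (cases "e = a + int n")
      case True then show ?thesis using 2 bracket_le[OF u n, of a] by simp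
    next
      case False
      then have "\<not> int n dvd e - a"
        using not_dvd_between[of a e n] down_arc_lt[OF ae] down_arc_left(3)[OF u n ae] by simp
      then show ?thesis using down_arc_right_value[OF ae g 2] off by blast
    qed
    then have "g a = u a" using le_funD[OF le(2), of a] by simp
    then have "g = set_class n u a (u a)" using off eq_set_class_iff[OF g n] by blast
    then show ?thesis using set_class_self[OF u n] by simp
  qed
qed

text \<open>Among the positions where \<open>g\<close> is smaller than \<open>u\<close>, take one with the shortest interval of \<open>g\<close>. At
  its later positions \<open>g\<close> and \<open>u\<close> agree, so it cannot reach the right end of the down arc of \<open>u\<close>.\<close>

lemma below_some_lowered:
  assumes g: "bracket n g" and le: "g \<le> u" "g \<noteq> u"
  obtains a e where "(a, e) \<in> down_arcs n u" "g \<le> set_class n u a (e - 1)"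
proof -
  define P where "P k \<longleftrightarrow> (\<exists>x. g x < u x \<and> nat (g x - x) = k)" for k
  have "\<exists>x. g x < u x" using le by (metis antisym le_fun_def linorder_not_less)
  then obtain k where k: "P k" "\<And>j. j < k \<Longrightarrow> \<not> P j" by (metis LeastI not_less_Least P_def)
  then obtain a where a: "g a < u a" "nat (g a - a) = k" by (auto simp: P_def)
  obtain e where ae: "(a, e) \<in> down_arcs n u"
    using down_arc_exists[OF u n, of a] a bracket_ge[OF g n, of a] by auto
  have "g a \<le> e - 1"
  proof (rule ccontr)
    assume "\<not> g a \<le> e - 1"
    then have e: "e \<le> g a" "a < e" using down_arc_lt[OF ae] by auto
    have "g e \<le> g a" using bracket_nested[OF g n, of a e] e a bracket_le[OF u n, of a] by simp
    then have "nat (g e - e) < k" using e a(2) by simp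
    then have "\<not> g e < u e" using k(2) P_def by blast
    then have "g e = u e" using le_funD[OF le(1), of e] by simp
    then show False using down_arc_right_value[OF ae g e(1)] a by simp
  qed
  then have "g \<le> set_class n u a (e - 1)" using le_set_class_iff[OF g n] le_funD[OF le(1)] by blast
  then show ?thesis using that ae by blast
qed

lemma lowered_le:
  assumes ae: "(a, e) \<in> down_arcs n u"
  shows "set_class n u a (e - 1) \<le> u" "set_class n u a (e - 1) \<noteq> u"
proof -
  show "set_class n u a (e - 1) \<le> u"
    using set_class_le_iff[OF u n, of u a "e - 1"] down_arc_left(2)[OF u n ae] by simp
  show "set_class n u a (e - 1) \<noteq> u"
  proof
    assume "set_class n u a (e - 1) = u"
    then have "u a = e - 1" using set_class_at[of n u a "e - 1"] by simp
    then show False using down_arc_left(2)[OF u n ae] by simp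
  qed
qed

lemma up_arc_of_lowered:
  assumes v: "bracket n v" and ae: "(a, e) \<in> down_arcs n v" and uv: "u = set_class n v a (e - 1)"
  shows "(a, e) \<in> up_arcs n u"
proof -
  have ua: "u a = e - 1" using uv by simp
  have fin: "u a < a + int n" using ua down_arc_left(3)[OF v n ae] by simp
  have "u b \<noteq> u a" if b: "b < a" for b
  proof
    assume eq: "u b = u a"
    have finb: "u b < b + int n" using bracket_value_finite[OF u n fin eq] .
    have "\<not> int n dvd b - a" using bracket_class[OF u n, of b a] eq b by auto
    then have vb: "v b = u b" using uv by (simp add: set_class_off)
    have "v a \<le> v b"
      using bracket_nested[OF v n, of b a] finb vb eq b bracket_ge[OF u n, of a] by simp
    then show False using vb eq ua down_arc_left(2)[OF v n ae] by simp
  qed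
  then show ?thesis using fin ua by (simp add: up_arcs_def)
qed

text \<open>The value at \<open>a\<close> is raised to that of \<open>e = u a + 1\<close>, the next possible one. An interval from before
  \<open>a\<close> that reaches \<open>a\<close> ends beyond \<open>u a\<close> because \<open>a\<close> is leftmost with its value; so it reaches \<open>e\<close>
  and contains the new interval.\<close>

lemma up_arc_imp_raised:
  assumes ae: "(a, e) \<in> up_arcs n u"
  obtains v where "bracket n v" "(a, e) \<in> down_arcs n v" "u = set_class n v a (e - 1)"
proof -
  have fin: "u a < a + int n" and e: "e = u a + 1" and left: "\<And>b. b < a \<Longrightarrow> u b \<noteq> u a"
    using ae by (auto simp: up_arcs_def)
  have ae_le: "a < e" "e \<le> a + int n" using fin e bracket_ge[OF u n, of a] by auto
  \<comment> \<open>The minimum takes care of infinite intervals: if \<open>u e \<ge> a + n\<close>, the interval of \<open>a\<close> becomes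
    infinite. This includes the case \<open>e = a + n\<close>.\<close>
  define c where "c = min (u e) (a + int n)"
  define v where "v = set_class n u a c"
  have ce: "e \<le> c" using bracket_ge[OF u n, of e] ae_le by (simp add: c_def)
  have v: "bracket n v"
    unfolding v_def
  proof (rule bracket_set_class[OF u n])
    show "a \<le> c" "c \<le> a + int n" using ce ae_le by (auto simp: c_def)
    fix z assume "c < a + int n" "a < z" "z \<le> c"
    then have c: "c = u e" "e < a + int n" using ce by (auto simp: c_def)
    show "u z \<le> c"
    proof (cases "z \<le> u a")
      case True
      then show ?thesis using bracket_nested[OF u n fin, of z] \<open>a < z\<close> ce e by simp
    next
      case False
      then show ?thesis 
        using bracket_nested[OF u n, of e z] \<open>z \<le> c\<close> c e \<open>c < a + int n\<close> ae_le by simp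
    qed
  next
    fix x assume x: "x < a" "a \<le> u x" "u x < x + int n"
    then have "u a \<le> u x" using bracket_nested[OF u n, of x a] by simp
    then have "e \<le> u x" using left[OF x(1)] e by simp
    then show "c \<le> u x" using bracket_nested[OF u n, of x e] x ae_le by (simp add: c_def)
  qed
  have off: "v x = u x" if "a < x" "x < a + int n" for x
    using not_dvd_between[OF that] by (simp add: v_def set_class_off)
  have va: "v a = c" by (simp add: v_def)
  have right: "same_closing n v a e"
  proof (cases "e = a + int n")
    case True
    then have "c = a + int n" using ce by (simp add: c_def)
    then show ?thesis using True va bracket_shift[OF v n, of a] by (simp add: same_closing_def)
  next
    case False
    then have e': "e < a + int n" and ve: "v e = u e" using off ae_le by auto
    show ?thesis
    proof (cases "u e < a + int n")
      case True then show ?thesis using va ve by (simp add: same_closing_def c_def)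
    next
      case inf: False
      have "u e = e + int n"
      proof (rule ccontr)
        assume "u e \<noteq> e + int n"
        then have fe: "u e < e + int n" using bracket_le[OF u n, of e] by simp
        have "u (a + int n) \<le> u e" using bracket_nested[OF u n fe, of "a + int n"] inf e' by simp
        then have "u (e - int n) = u a"
          using fe e bracket_shift[OF u n, of a] bracket_shift[OF u n, of "e - int n"] by simp
        then show False using left[of "e - int n"] e' by simp
      qed
      then show ?thesis using inf va ve by (simp add: same_closing_def c_def)
    qed
  qed
  have "\<not> same_closing n v a x" if x: "a < x" "x < e" for x
  proof -
    have "v x \<le> e - 1" using off[of x] bracket_nested[OF u n fin, of x] x e ae_le by simp
    then show ?thesis using va ce x ae_le by (auto simp: same_closing_def)
  qed
  then have "(a, e) \<in> down_arcs n v" using right ae_le by (simp add: down_arcs_def)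
  moreover have "u = set_class n v a (e - 1)"
    using eq_set_class_iff[OF u n, of v a "e - 1"] e by (simp add: v_def set_class_off)
  ultimately show ?thesis using that v by blast
qed

end

text \<open>The bracket vectors of the join-irreducibles, if \<open>a < e \<le> a + n\<close>.\<close>

definition peak :: "nat \<Rightarrow> int \<Rightarrow> int \<Rightarrow> int \<Rightarrow> int" where
  "peak n a e = set_class n (\<lambda>x. x) a e"

lemma bracket_id: "bracket n (\<lambda>x. x)"
  by (simp add: bracket_def)

lemma bracket_peak: "n > 0 \<Longrightarrow> a \<le> e \<Longrightarrow> e \<le> a + int n \<Longrightarrow> bracket n (peak n a e)"
  unfolding peak_def by (rule bracket_set_class[OF bracket_id]) auto

lemma peak_at [simp]: "peak n a e a = e" by (simp add: peak_def)

lemma peak_off: "\<not> int n dvd x - a \<Longrightarrow> peak n a e x = x" by (simp add: peak_def set_class_off)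

lemma peak_shift: "peak n (a + k * int n) (e + k * int n) = peak n a e"
  by (simp add: peak_def set_class_shift)

lemma peak_le_iff: 
  assumes "bracket n u" "n > 0" shows "peak n a e \<le> u \<longleftrightarrow> e \<le> u a"
  unfolding peak_def using set_class_le_iff[OF assms, of "\<lambda>x. x" a e] bracket_ge[OF assms] by simp

lemma below_peak:
  assumes u: "bracket n u" and n: "n > 0" and "u \<le> peak n a e" "u \<noteq> peak n a e"
  shows "u \<le> peak n a (e - 1)"
proof -
  have off: "u x = x" if "\<not> int n dvd x - a" for x
    using le_funD[OF assms(3), of x] peak_off[OF that] bracket_ge[OF u n, of x] by simp
  then have "u a \<noteq> e" using assms(4) eq_set_class_iff[OF u n, of "\<lambda>x. x" a e] unfolding peak_def by blast
  then have "u a \<le> e - 1" using le_funD[OF assms(3), of a] by simp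
  then show ?thesis using off le_set_class_iff[OF u n] unfolding peak_def by simp
qed

lemma peak_inj:
  assumes eq: "peak n a e = peak n b f" and "a < e" "b < f"
  obtains k where "b = a + k * int n" "f = e + k * int n"
proof -
  have "peak n a e b = f" using eq by simp
  then have d: "int n dvd b - a" and f: "f = e + (b - a)" using assms(3)
    by (auto simp: peak_def set_class_def split: if_splits)
  from d obtain k where "b - a = int n * k" by (elim dvdE)
  then show ?thesis using f by (intro that[of k]) (auto simp: algebra_simps)
qed

text \<open>The largest bracket vector with value \<open>e - 1\<close> at \<open>a\<close>: the positions in \<open>[a, e - 1]\<close> all get this
  value, and the other residue classes are infinite. It belongs to \<open>\<kappa>\<close> of the join-irreducible with
  arc \<open>(a, e)\<close>.\<close>

definition pit :: "nat \<Rightarrow> int \<Rightarrow> int \<Rightarrow> int \<Rightarrow> int" where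
  "pit n a e x = x + (let m = (x - a) mod int n in if m < e - a then e - 1 - a - m else int n)"

lemma bracket_pit:
  assumes n: "n > 0" and ae: "a < e" "e \<le> a + int n"
  shows "bracket n (pit n a e)"
proof (rule bracketI)
  have m: "0 \<le> (x - a) mod int n" "(x - a) mod int n < int n" for x using n by simp_all
  show "x \<le> pit n a e x" "pit n a e x \<le> x + int n" for x
  proof -
    show "x \<le> pit n a e x" using m[of x] ae by (simp add: pit_def Let_def)
    show "pit n a e x \<le> x + int n"
    proof (cases "(x - a) mod int n < e - a")
      case True
      have "e - 1 - a - (x - a) mod int n \<le> int n" using m(1)[of x] ae(2) by linarith
      then show ?thesis using True by (simp add: pit_def Let_def)
    qed (simp add: pit_def Let_def)
  qed
  show "pit n a e (x + int n) = pit n a e x + int n" for x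
  proof -
    have "(x + int n - a) mod int n = (x - a) mod int n"
      using mod_add_self2[of "x - a" "int n"] by (simp add: algebra_simps)
    then show ?thesis by (simp add: pit_def Let_def)
  qed
  fix x z assume x: "pit n a e x < x + int n" "x < z" "z \<le> pit n a e x"
  let ?m = "(x - a) mod int n"
  have lt: "?m < e - a" using x(1) by (simp add: pit_def Let_def split: if_splits)
  then have px: "pit n a e x = x + (e - 1 - a - ?m)" by (simp add: pit_def Let_def)
  have "(z - a) mod int n = (?m + (z - x)) mod int n" by (simp add: mod_add_left_eq)
  also have "\<dots> = ?m + (z - x)" using x px m[of x] ae by (intro mod_pos_pos_trivial) auto
  finally have mz: "(z - a) mod int n = ?m + (z - x)" .
  show "pit n a e z \<le> pit n a e x" unfolding px using mz x px by (simp add: pit_def Let_def)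
qed

lemma pit_at: "a < e \<Longrightarrow> pit n a e a = e - 1"
  by (simp add: pit_def)

lemma le_pit:
  assumes u: "bracket n u" and n: "n > 0" and ae: "a < e" "e \<le> a + int n" and ua: "u a = e - 1"
  shows "u \<le> pit n a e"
proof (rule le_funI)
  fix x
  let ?m = "(x - a) mod int n"
  show "u x \<le> pit n a e x"
  proof (cases "?m < e - a")
    case True
    have "u (a + ?m) \<le> e - 1"
      using bracket_nested[OF u n, of a "a + ?m"] ua ae True n by simp
    moreover have "u x = u (a + ?m) + (x - (a + ?m))"
    proof (rule bracket_class[OF u n])
      have "x - (a + ?m) = int n * ((x - a) div int n)"
        using minus_mod_eq_mult_div[of "x - a" "int n"] by linarith
      then show "int n dvd x - (a + ?m)" by (simp only: dvd_triv_left)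
    qed
    ultimately show ?thesis using True by (simp add: pit_def Let_def)
  next
    case False
    then show ?thesis using bracket_le[OF u n, of x] by (simp add: pit_def Let_def)
  qed
qed

section \<open>Cover labels in the cyclic Tamari lattice\<close>

locale cyclic_tamari =
  fixes n :: nat
  assumes n: "n > 0"
begin

abbreviation "L \<equiv> CTam n"
abbreviation "B \<equiv> bracket_of n"

lemma B_bracket: "r \<in> carrier L \<Longrightarrow> bracket n (B r)"
  using bracket_bracket_of n by blast

lemma B_tito_of: "bracket n u \<Longrightarrow> B (tito_of n u) = u"
  using bracket_of_tito_of n by blast

lemma tito_of_in: "bracket n u \<Longrightarrow> tito_of n u \<in> carrier L"
  using tito_of_carrier n by blast

lemma B_inject: "r \<in> carrier L \<Longrightarrow> s \<in> carrier L \<Longrightarrow> B r = B s \<longleftrightarrow> r = s"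
  using tito_of_bracket_of n by metis

lemma le_iff: "r \<in> carrier L \<Longrightarrow> s \<in> carrier L \<Longrightarrow> r \<sqsubseteq>\<^bsub>L\<^esub> s \<longleftrightarrow> B r \<le> B s"
  using CTam_le_iff n by (simp add: le_fun_def)

lemma less_iff: "r \<in> carrier L \<Longrightarrow> s \<in> carrier L \<Longrightarrow> r \<sqsubset>\<^bsub>L\<^esub> s \<longleftrightarrow> B r < B s"
  using B_inject[of r s] by (simp add: lless_def le_iff less_le) (simp add: CTam_def)

lemma ex_carrier_iff: "(\<exists>z\<in>carrier L. P (B z)) \<longleftrightarrow> (\<exists>g. bracket n g \<and> P g)"
  using B_bracket B_tito_of tito_of_in by metis

lemma lattice_CTam: "lattice L"
proof -
  have eq: "(.=\<^bsub>L\<^esub>) = (=)" by (simp add: CTam_def)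
  interpret partial_order L
    by unfold_locales (auto simp: eq le_iff B_inject dest: antisym order_trans)
  show ?thesis
  proof unfold_locales
    fix x y assume x: "x \<in> carrier L" and y: "y \<in> carrier L"
    let ?G = "{g. bracket n g \<and> B x \<le> g \<and> B y \<le> g}"
    have "bracket n (\<lambda>x. x + int n)" by (rule bracketI) auto
    moreover have "B x \<le> (\<lambda>x. x + int n)" "B y \<le> (\<lambda>x. x + int n)"
      using bracket_le[OF B_bracket n] x y by (auto simp: le_fun_def)
    ultimately have ne: "?G \<noteq> {}" by blast
    define m where "m z = Min ((\<lambda>g. g z) ` ?G)" for z
    have m: "bracket n m" "\<And>g. g \<in> ?G \<Longrightarrow> m \<le> g" "\<And>z. \<exists>g\<in>?G. m z = g z"
      using bracket_Min[OF n _ ne] unfolding m_def by blast+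
    have xm: "v \<le> m" if v: "\<forall>g\<in>?G. v \<le> g" for v
    proof (rule le_funI)
      fix z
      obtain g where "g \<in> ?G" "m z = g z" using m(3) by blast
      then show "v z \<le> m z" using v le_funD[of v g z] by simp
    qed
    note t = tito_of_in[OF m(1)]
    have tx: "tito_of n m \<sqsubseteq>\<^bsub>L\<^esub> z \<longleftrightarrow> m \<le> B z" "z \<sqsubseteq>\<^bsub>L\<^esub> tito_of n m \<longleftrightarrow> B z \<le> m"
      if "z \<in> carrier L" for z
      using le_iff[OF t that] le_iff[OF that t] B_tito_of[OF m(1)] by simp_all
    have "least L (tito_of n m) (Upper L {x, y})"
    proof (rule least_UpperI)
      show "tito_of n m \<in> carrier L" "{x, y} \<subseteq> carrier L" using t x y by auto
      have "B x \<le> m" "B y \<le> m" by (rule xm, blast)+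
      then have "x \<sqsubseteq>\<^bsub>L\<^esub> tito_of n m" "y \<sqsubseteq>\<^bsub>L\<^esub> tito_of n m"
        using tx(2)[OF x] tx(2)[OF y] by simp_all
      then show "z \<sqsubseteq>\<^bsub>L\<^esub> tito_of n m" if "z \<in> {x, y}" for z using that by (metis insertE singletonD)
      fix z assume "z \<in> Upper L {x, y}"
      then have zU: "x \<sqsubseteq>\<^bsub>L\<^esub> z" "y \<sqsubseteq>\<^bsub>L\<^esub> z" and z: "z \<in> carrier L"
        using x y unfolding Upper_def by blast+
      then have "B x \<le> B z" "B y \<le> B z" using le_iff x y by blast+
      then have "m \<le> B z" using B_bracket z by (intro m(2)) blast
      then show "tito_of n m \<sqsubseteq>\<^bsub>L\<^esub> z" using tx(1)[OF z] by simp
    qed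
    then show "\<exists>s. least L s (Upper L {x, y})" ..
  next
    fix x y assume x: "x \<in> carrier L" and y: "y \<in> carrier L"
    let ?m = "\<lambda>z. Min ((\<lambda>g. g z) ` {B x, B y})"
    have m: "bracket n ?m" "?m \<le> B x" "?m \<le> B y" "\<And>z. \<exists>g\<in>{B x, B y}. ?m z = g z"
      using bracket_Min[OF n, of "{B x, B y}"] B_bracket x y by blast+
    have "greatest L (tito_of n ?m) (Lower L {x, y})"
    proof (rule greatest_LowerI)
      show "tito_of n ?m \<in> carrier L" "{x, y} \<subseteq> carrier L" using m x y tito_of_in by auto
      have "tito_of n ?m \<sqsubseteq>\<^bsub>L\<^esub> x" "tito_of n ?m \<sqsubseteq>\<^bsub>L\<^esub> y"
        using m(2,3) unfolding le_iff[OF tito_of_in[OF m(1)] x] le_iff[OF tito_of_in[OF m(1)] y]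
          B_tito_of[OF m(1)] .
      then show "tito_of n ?m \<sqsubseteq>\<^bsub>L\<^esub> z" if "z \<in> {x, y}" for z using that by (metis insertE singletonD)
      fix z assume "z \<in> Lower L {x, y}"
      then have zL: "z \<sqsubseteq>\<^bsub>L\<^esub> x" "z \<sqsubseteq>\<^bsub>L\<^esub> y" and z: "z \<in> carrier L"
        using x y unfolding Lower_def by blast+
      then have "B z \<le> B x" "B z \<le> B y" using le_iff x y by blast+
      then have "B z \<le> ?m" by (simp add: le_fun_def)
      then show "z \<sqsubseteq>\<^bsub>L\<^esub> tito_of n ?m"
        unfolding le_iff[OF z tito_of_in[OF m(1)]] B_tito_of[OF m(1)] .
    qed
    then show "\<exists>s. greatest L s (Lower L {x, y})" ..
  qed
qed

sublocale lattice L by (rule lattice_CTam)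

lemma B_meet:
  assumes x: "x \<in> carrier L" and y: "y \<in> carrier L"
  shows "B (x \<sqinter>\<^bsub>L\<^esub> y) = (\<lambda>z. min (B x z) (B y z))"
proof (rule antisym)
  have c: "x \<sqinter>\<^bsub>L\<^esub> y \<in> carrier L" using x y by simp
  show "B (x \<sqinter>\<^bsub>L\<^esub> y) \<le> (\<lambda>z. min (B x z) (B y z))"
    using meet_left[OF x y] meet_right[OF x y] c x y by (simp add: le_iff le_fun_def)
  let ?m = "\<lambda>z. Min ((\<lambda>g. g z) ` {B x, B y})"
  have eq: "?m = (\<lambda>z. min (B x z) (B y z))" by auto
  have m: "bracket n ?m" "?m \<le> B x" "?m \<le> B y"
    using bracket_Min(1,2)[OF n, of "{B x, B y}"] B_bracket x y by blast+
  have "tito_of n ?m \<sqsubseteq>\<^bsub>L\<^esub> x \<sqinter>\<^bsub>L\<^esub> y"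
    using m x y tito_of_in[OF m(1)] B_tito_of[OF m(1)] by (intro meet_le) (simp_all only: le_iff)
  then show "(\<lambda>z. min (B x z) (B y z)) \<le> B (x \<sqinter>\<^bsub>L\<^esub> y)"
    using le_iff[OF tito_of_in[OF m(1)] c] B_tito_of[OF m(1)] eq by simp
qed

lemma join_eq_iff:
  assumes x: "x \<in> carrier L" and y: "y \<in> carrier L" and t: "t \<in> carrier L"
  shows "x \<squnion>\<^bsub>L\<^esub> y = t \<longleftrightarrow> B x \<le> B t \<and> B y \<le> B t \<and> (\<forall>g. bracket n g \<longrightarrow> B x \<le> g \<longrightarrow> B y \<le> g \<longrightarrow> B t \<le> g)"
proof
  assume j: "x \<squnion>\<^bsub>L\<^esub> y = t"
  have "B t \<le> g" if g: "bracket n g" and le: "B x \<le> g" "B y \<le> g" for g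
  proof -
    note tg = tito_of_in[OF g]
    have "x \<squnion>\<^bsub>L\<^esub> y \<sqsubseteq>\<^bsub>L\<^esub> tito_of n g"
    proof (rule join_le[OF _ _ x y tg])
      show "x \<sqsubseteq>\<^bsub>L\<^esub> tito_of n g" "y \<sqsubseteq>\<^bsub>L\<^esub> tito_of n g"
        unfolding le_iff[OF x tg] le_iff[OF y tg] B_tito_of[OF g] by (rule le)+
    qed
    then show ?thesis unfolding j le_iff[OF t tg] B_tito_of[OF g] .
  qed
  moreover have "B x \<le> B t" "B y \<le> B t"
    using join_left[OF x y] join_right[OF x y] unfolding j le_iff[OF x t] le_iff[OF y t] .
  ultimately show "B x \<le> B t \<and> B y \<le> B t \<and> (\<forall>g. bracket n g \<longrightarrow> B x \<le> g \<longrightarrow> B y \<le> g \<longrightarrow> B t \<le> g)" by blast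
next
  assume R: "B x \<le> B t \<and> B y \<le> B t \<and> (\<forall>g. bracket n g \<longrightarrow> B x \<le> g \<longrightarrow> B y \<le> g \<longrightarrow> B t \<le> g)"
  have c: "x \<squnion>\<^bsub>L\<^esub> y \<in> carrier L" using x y by simp
  have "x \<squnion>\<^bsub>L\<^esub> y \<sqsubseteq>\<^bsub>L\<^esub> t"
    using R le_iff[OF x t] le_iff[OF y t] by (intro join_le[OF _ _ x y t]) blast+
  then have "B (x \<squnion>\<^bsub>L\<^esub> y) \<le> B t" unfolding le_iff[OF c t] .
  moreover have "B x \<le> B (x \<squnion>\<^bsub>L\<^esub> y)" "B y \<le> B (x \<squnion>\<^bsub>L\<^esub> y)"
    using join_left[OF x y] join_right[OF x y] unfolding le_iff[OF x c] le_iff[OF y c] .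
  then have "B t \<le> B (x \<squnion>\<^bsub>L\<^esub> y)" using R B_bracket[OF c] by blast
  ultimately show "x \<squnion>\<^bsub>L\<^esub> y = t" using B_inject[OF c t] by simp
qed

lemma B_bottom: "B \<bottom>\<^bsub>L\<^esub> = (\<lambda>x. x)" and bottom_in: "\<bottom>\<^bsub>L\<^esub> \<in> carrier L"
proof -
  let ?b = "tito_of n (\<lambda>x. x)"
  note i = bracket_id[of n]
  have le: "?b \<sqsubseteq>\<^bsub>L\<^esub> r" if r: "r \<in> carrier L" for r
    unfolding le_iff[OF tito_of_in[OF i] r] B_tito_of[OF i]
    by (rule le_funI) (rule bracket_ge[OF B_bracket[OF r] n])
  have least: "least L ?b (carrier L)" unfolding least_def using tito_of_in[OF i] le by blast
  then have bot: "least L \<bottom>\<^bsub>L\<^esub> (carrier L)" unfolding bottom_def by (rule someI)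
  then show c: "\<bottom>\<^bsub>L\<^esub> \<in> carrier L" unfolding least_def by blast
  have "\<bottom>\<^bsub>L\<^esub> = ?b" by (rule least_unique[OF bot least])
  then show "B \<bottom>\<^bsub>L\<^esub> = (\<lambda>x. x)" by (simp only: B_tito_of[OF i])
qed

lemma covered_by_iff:
  assumes x: "x \<in> carrier L" and y: "y \<in> carrier L"
  shows "covered_by L x y \<longleftrightarrow> B x < B y \<and> \<not> (\<exists>g. bracket n g \<and> B x < g \<and> g < B y)"
proof -
  have "(\<exists>z\<in>carrier L. x \<sqsubset>\<^bsub>L\<^esub> z \<and> z \<sqsubset>\<^bsub>L\<^esub> y) \<longleftrightarrow> (\<exists>z\<in>carrier L. B x < B z \<and> B z < B y)"
    using x y by (auto simp: less_iff)
  then show ?thesis using x y ex_carrier_iff[of "\<lambda>g. B x < g \<and> g < B y"]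
    by (simp add: covered_by_def less_iff)
qed

lemma covered_by_lowered:
  assumes x: "x \<in> carrier L" and u: "u \<in> carrier L"
  shows "covered_by L x u \<longleftrightarrow> (\<exists>a e. (a, e) \<in> down_arcs n (B u) \<and> B x = set_class n (B u) a (e - 1))"
proof
  note bu = B_bracket[OF u] and bx = B_bracket[OF x]
  assume "covered_by L x u"
  then have c: "B x < B u" "\<not> (\<exists>g. bracket n g \<and> B x < g \<and> g < B u)"
    using covered_by_iff[OF x u] by auto
  then obtain a e where ae: "(a, e) \<in> down_arcs n (B u)" "B x \<le> set_class n (B u) a (e - 1)"
    using below_some_lowered[OF bu n bx] by (auto simp: less_le)
  then show "\<exists>a e. (a, e) \<in> down_arcs n (B u) \<and> B x = set_class n (B u) a (e - 1)"
    using c(2) bracket_lowered[OF bu n ae(1)] lowered_le[OF bu n ae(1)] by (metis less_le)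
next
  note bu = B_bracket[OF u] and bx = B_bracket[OF x]
  assume "\<exists>a e. (a, e) \<in> down_arcs n (B u) \<and> B x = set_class n (B u) a (e - 1)"
  then obtain a e where ae: "(a, e) \<in> down_arcs n (B u)" "B x = set_class n (B u) a (e - 1)" by blast
  then show "covered_by L x u"
    using covered_by_iff[OF x u] lowered_le[OF bu n ae(1)] between_lowered[OF bu n ae(1)]
    by (metis less_le)
qed

definition label :: "int \<Rightarrow> int \<Rightarrow> int rel" where
  "label a e = tito_of n (peak n a e)"

lemma label_in: "a \<le> e \<Longrightarrow> e \<le> a + int n \<Longrightarrow> label a e \<in> carrier L"
  and B_label: "a \<le> e \<Longrightarrow> e \<le> a + int n \<Longrightarrow> B (label a e) = peak n a e"
  using bracket_peak[OF n] by (simp_all add: label_def tito_of_in B_tito_of)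

lemma peak_pred_less:
  assumes "a < e" "e \<le> a + int n"
  shows "peak n a (e - 1) < peak n a e"
proof -
  have "peak n a (e - 1) \<le> peak n a e"
    using peak_le_iff[OF bracket_peak[OF n, of a e] n, of a "e - 1"] assms by simp
  moreover have "peak n a (e - 1) \<noteq> peak n a e"
  proof
    assume "peak n a (e - 1) = peak n a e"
    then have "peak n a (e - 1) a = peak n a e a" by (rule fun_cong)
    then show False unfolding peak_at by simp
  qed
  ultimately show ?thesis by (rule le_neq_trans)
qed

text \<open>If a bracket vector has down arcs starting in two residue classes, the two lower covers differ
  from it on disjoint sets of positions, so it is their join. Conversely everything strictly below
  a peak is below the next lower peak.\<close>

lemma join_irreducible_iff:
  assumes j: "j \<in> carrier L"
  shows "join_irreducible L j \<longleftrightarrow> (\<exists>a e. a < e \<and> e \<le> a + int n \<and> B j = peak n a e)"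
proof
  note bj = B_bracket[OF j]
  assume ji: "join_irreducible L j"
  then have "B j \<noteq> (\<lambda>x. x)" using B_inject[OF j bottom_in] B_bottom by (auto simp: join_irreducible_def)
  then obtain a where "B j a \<noteq> a" by auto
  then have a: "a < B j a" using bracket_ge[OF bj n, of a] by simp
  then obtain e where ae: "(a, e) \<in> down_arcs n (B j)" using down_arc_exists[OF bj n] by blast
  have "B j x = x" if x: "\<not> int n dvd x - a" for x
  proof (rule ccontr)
    assume "B j x \<noteq> x"
    then have "x < B j x" using bracket_ge[OF bj n, of x] by simp
    then obtain f where xf: "(x, f) \<in> down_arcs n (B j)" using down_arc_exists[OF bj n] by blast
    let ?p = "set_class n (B j) a (e - 1)" and ?q = "set_class n (B j) x (f - 1)"
    have p: "bracket n ?p" "?p \<le> B j" "?p \<noteq> B j" and q: "bracket n ?q" "?q \<le> B j" "?q \<noteq> B j"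
      using bracket_lowered[OF bj n] lowered_le[OF bj n] ae xf by blast+
    have "tito_of n ?p \<squnion>\<^bsub>L\<^esub> tito_of n ?q = j"
    proof (subst join_eq_iff)
      show "tito_of n ?p \<in> carrier L" "tito_of n ?q \<in> carrier L" "j \<in> carrier L"
        using p q tito_of_in j by auto
      have "B j \<le> g" if g: "bracket n g" "?p \<le> g" "?q \<le> g" for g
      proof (rule le_funI)
        fix z
        have "\<not> int n dvd z - a \<or> \<not> int n dvd z - x"
          using x dvd_diff[of "int n" "z - a" "z - x"] by auto
        then show "B j z \<le> g z"
          using g set_class_le_iff[OF g(1) n, of "B j" a "e - 1"] set_class_le_iff[OF g(1) n, of "B j" x "f - 1"]
          by blast
      qed
      then show "B (tito_of n ?p) \<le> B j \<and> B (tito_of n ?q) \<le> B j \<and>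
        (\<forall>g. bracket n g \<longrightarrow> B (tito_of n ?p) \<le> g \<longrightarrow> B (tito_of n ?q) \<le> g \<longrightarrow> B j \<le> g)"
        using p q by (simp add: B_tito_of)
    qed
    then have "tito_of n ?p = j \<or> tito_of n ?q = j"
      by (rule ji[unfolded join_irreducible_def, THEN conjunct2, THEN conjunct2, rule_format,
            OF tito_of_in[OF p(1)] tito_of_in[OF q(1)]])
    then have "?p = B j \<or> ?q = B j" using B_tito_of[OF p(1)] B_tito_of[OF q(1)] by metis
    then show False using p(3) q(3) by blast
  qed
  then have "B j = peak n a (B j a)"
    using eq_set_class_iff[OF bj n, of "\<lambda>x. x" a "B j a"] by (simp add: peak_def)
  then show "\<exists>a e. a < e \<and> e \<le> a + int n \<and> B j = peak n a e" using a bracket_le[OF bj n] by blast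
next
  assume "\<exists>a e. a < e \<and> e \<le> a + int n \<and> B j = peak n a e"
  then obtain a e where ae: "a < e" "e \<le> a + int n" and Bj: "B j = peak n a e" by blast
  have "j \<noteq> \<bottom>\<^bsub>L\<^esub>"
  proof
    assume "j = \<bottom>\<^bsub>L\<^esub>"
    then have "peak n a e = (\<lambda>x. x)" using Bj B_bottom by (simp only:)
    then have "e = a" using peak_at[of n a e] by (simp only:)
    then show False using ae by simp
  qed
  moreover have "x = j \<or> y = j" if x: "x \<in> carrier L" and y: "y \<in> carrier L" and xy: "x \<squnion>\<^bsub>L\<^esub> y = j" for x y
  proof (rule ccontr)
    assume "\<not> (x = j \<or> y = j)"
    then have "B x \<noteq> B j" "B y \<noteq> B j" using B_inject[OF x j] B_inject[OF y j] by blast+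
    moreover have "B x \<le> B j" "B y \<le> B j" using join_eq_iff[OF x y j] xy by blast+
    ultimately have "B x \<le> peak n a (e - 1)" "B y \<le> peak n a (e - 1)"
      using below_peak[OF B_bracket[OF x] n, of a e] below_peak[OF B_bracket[OF y] n, of a e]
      unfolding Bj by blast+
    moreover have "bracket n (peak n a (e - 1))" using bracket_peak[OF n, of a "e - 1"] ae by simp
    ultimately have "B j \<le> peak n a (e - 1)" using join_eq_iff[OF x y j] xy by blast
    then show False using peak_pred_less[OF ae] unfolding Bj less_le_not_le by blast
  qed
  ultimately show "join_irreducible L j" using j unfolding join_irreducible_def by blast
qed

lemma lower_cover_label:
  assumes ae: "a < e" "e \<le> a + int n"
  shows "lower_cover L (label a e) = label a (e - 1)"
  unfolding lower_cover_def
proof (rule the_equality)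
  have l: "label a e \<in> carrier L" "B (label a e) = peak n a e"
    and l': "label a (e - 1) \<in> carrier L" "B (label a (e - 1)) = peak n a (e - 1)"
    using label_in B_label ae by auto
  have below: "g \<le> peak n a (e - 1)" if "bracket n g" "g < peak n a e" for g
    using below_peak[OF that(1) n] that(2) by (auto simp: less_le)
  show "covered_by L (label a (e - 1)) (label a e)"
    unfolding covered_by_iff[OF l'(1) l(1)] l(2) l'(2)
    using peak_pred_less[OF ae] below by (metis less_le_not_le)
  fix x assume c: "covered_by L x (label a e)"
  then have x: "x \<in> carrier L" by (simp add: covered_by_def)
  have "bracket n (peak n a (e - 1))" using bracket_peak[OF n, of a "e - 1"] ae by simp
  then have "B x < peak n a e" "\<not> B x < peak n a (e - 1)"
    using c peak_pred_less[OF ae] unfolding covered_by_iff[OF x l(1)] l(2) by blast+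
  moreover have "B x \<le> peak n a (e - 1)" using below[OF B_bracket[OF x]] calculation by blast
  ultimately have "B x = peak n a (e - 1)" using le_neq_trans by blast
  then show "x = label a (e - 1)" using B_inject[OF x l'(1)] unfolding l'(2) by blast
qed

lemma kappa_label:
  assumes ae: "a < e" "e \<le> a + int n"
  shows "kappa L (label a e) = tito_of n (pit n a e)"
proof -
  have l: "label a e \<in> carrier L" "B (label a e) = peak n a e"
    and l': "label a (e - 1) \<in> carrier L" "B (label a (e - 1)) = peak n a (e - 1)"
    using label_in B_label ae by auto
  have eq: "z \<sqinter>\<^bsub>L\<^esub> label a e = label a (e - 1) \<longleftrightarrow> B z a = e - 1" if z: "z \<in> carrier L" for z
  proof -
    note zl = meet_closed[OF z l(1)]
    have "z \<sqinter>\<^bsub>L\<^esub> label a e = label a (e - 1) \<longleftrightarrow> B (z \<sqinter>\<^bsub>L\<^esub> label a e) = peak n a (e - 1)"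
      using B_inject[OF zl l'(1)] unfolding l'(2) by blast
    also have "\<dots> \<longleftrightarrow> B (z \<sqinter>\<^bsub>L\<^esub> label a e) a = e - 1 \<and>
        (\<forall>x. \<not> int n dvd x - a \<longrightarrow> B (z \<sqinter>\<^bsub>L\<^esub> label a e) x = x)"
      unfolding peak_def by (rule eq_set_class_iff[OF B_bracket[OF zl] n])
    also have "\<dots> \<longleftrightarrow> min (B z a) e = e - 1"
    proof -
      have "min (B z x) (peak n a e x) = x" if "\<not> int n dvd x - a" for x
        using bracket_ge[OF B_bracket[OF z] n, of x] peak_off[OF that, of e] by linarith
      then show ?thesis unfolding B_meet[OF z l(1)] l(2) peak_at by blast
    qed
    also have "\<dots> \<longleftrightarrow> B z a = e - 1" by linarith
    finally show ?thesis .
  qed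
  let ?p = "tito_of n (pit n a e)"
  have p: "?p \<in> carrier L" "B ?p = pit n a e"
    using tito_of_in[OF bracket_pit[OF n ae]] B_tito_of[OF bracket_pit[OF n ae]] .
  have p_in: "?p \<sqinter>\<^bsub>L\<^esub> label a e = label a (e - 1)"
    unfolding eq[OF p(1)] p(2) by (rule pit_at[OF ae(1)])
  have p_max: "z \<sqsubseteq>\<^bsub>L\<^esub> ?p" if "z \<in> carrier L" "z \<sqinter>\<^bsub>L\<^esub> label a e = label a (e - 1)" for z
    unfolding le_iff[OF that(1) p(1)] p(2)
    using le_pit[OF B_bracket[OF that(1)] n ae] eq[OF that(1)] that(2) by blast
  have g: "greatest L ?p {z \<in> carrier L. z \<sqinter>\<^bsub>L\<^esub> label a e = lower_cover L (label a e)}"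
    unfolding greatest_def lower_cover_label[OF ae]
    using p(1) p_in p_max by blast
  show ?thesis
    unfolding kappa_def
  proof (rule the_equality, rule g)
    fix z assume z: "greatest L z {z \<in> carrier L. z \<sqinter>\<^bsub>L\<^esub> label a e = lower_cover L (label a e)}"
    show "z = ?p" by (rule greatest_unique[OF z g])
  qed
qed

text \<open>The peak with arc \<open>(a, e)\<close> is the least bracket vector below \<open>u\<close> but not below the cover, and the
  maximality of \<open>\<kappa>\<close> shows that the cover lies below it. For uniqueness, evaluate at the position
  where a candidate peak is raised: it must lie in the class of \<open>a\<close>, and the two conditions on the
  label then fix its height.\<close>

lemma cover_label_lowered:
  assumes x: "x \<in> carrier L" and u: "u \<in> carrier L"
    and ae: "(a, e) \<in> down_arcs n (B u)" and Bx: "B x = set_class n (B u) a (e - 1)"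
  shows "cover_label L x u = label a e"
  unfolding cover_label_def
proof (rule the_equality)
  note bu = B_bracket[OF u] and bx = B_bracket[OF x]
  have b: "a < e" "e \<le> a + int n" "e \<le> B u a"
    using down_arc_lt[OF ae] down_arc_left[OF bu n ae] by auto
  have l: "label a e \<in> carrier L" "B (label a e) = peak n a e" using label_in B_label b by auto
  have xu: "B x \<le> B u" using lowered_le(1)[OF bu n ae] Bx by simp
  have kap: "kappa L (label c f) \<in> carrier L" "B (kappa L (label c f)) = pit n c f" 
    if "c < f" "f \<le> c + int n" for c f
    unfolding kappa_label[OF that]
    using tito_of_in[OF bracket_pit[OF n that]] B_tito_of[OF bracket_pit[OF n that]] .
  show "join_irreducible L (label a e) \<and> label a e \<squnion>\<^bsub>L\<^esub> x = u \<and> kappa L (label a e) \<sqinter>\<^bsub>L\<^esub> u = x"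
  proof (intro conjI)
    show "join_irreducible L (label a e)" using join_irreducible_iff[OF l(1)] l(2) b by blast
    show "label a e \<squnion>\<^bsub>L\<^esub> x = u"
    proof (subst join_eq_iff[OF l(1) x u], intro conjI allI impI)
      show "B (label a e) \<le> B u" unfolding l(2) using peak_le_iff[OF bu n] b by simp
      show "B x \<le> B u" by (rule xu)
      fix g assume g: "bracket n g" "B (label a e) \<le> g" "B x \<le> g"
      define h where "h = B (tito_of n g \<sqinter>\<^bsub>L\<^esub> u)"
      have h: "h = (\<lambda>z. min (g z) (B u z))"
        unfolding h_def B_meet[OF tito_of_in[OF g(1)] u] B_tito_of[OF g(1)] ..
      have bh: "bracket n h"
        unfolding h_def by (rule B_bracket[OF meet_closed[OF tito_of_in[OF g(1)] u]])
      have "B x \<le> h" "h \<le> B u"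
        unfolding h using le_funD[OF g(3)] le_funD[OF xu] by (simp_all add: le_fun_def)
      then consider "h = B x" | "h = B u" using between_lowered[OF bu n ae bh] unfolding Bx by blast
      then show "B u \<le> g"
      proof cases
        case 1
        have "e \<le> g a" using g(2) peak_le_iff[OF g(1) n] unfolding l(2) by blast
        then have "e \<le> h a" using b unfolding h by linarith
        then show ?thesis unfolding 1 Bx set_class_at by simp
      next
        case 2
        have "h \<le> g" unfolding h by (rule le_funI) (rule min.cobounded1)
        then show ?thesis unfolding 2 .
      qed
    qed
    have "B (kappa L (label a e) \<sqinter>\<^bsub>L\<^esub> u) = B x"
    proof (rule antisym)
      have m: "B (kappa L (label a e) \<sqinter>\<^bsub>L\<^esub> u) = (\<lambda>z. min (pit n a e z) (B u z))"
        unfolding B_meet[OF kap(1)[OF b(1,2)] u] kap(2)[OF b(1,2)] ..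
      have "bracket n (\<lambda>z. min (pit n a e z) (B u z))"
        unfolding m[symmetric] by (rule B_bracket[OF meet_closed[OF kap(1)[OF b(1,2)] u]])
      then show "B (kappa L (label a e) \<sqinter>\<^bsub>L\<^esub> u) \<le> B x"
        unfolding m Bx using le_set_class_iff[OF _ n] pit_at[OF b(1), of n] by simp
      have "B x a = e - 1" unfolding Bx by (rule set_class_at)
      then have "B x \<le> pit n a e" by (rule le_pit[OF bx n b(1,2)])
      then show "B x \<le> B (kappa L (label a e) \<sqinter>\<^bsub>L\<^esub> u)"
        unfolding m using xu by (simp add: le_fun_def)
    qed
    then show "kappa L (label a e) \<sqinter>\<^bsub>L\<^esub> u = x"
      using B_inject[OF meet_closed[OF kap(1)[OF b(1,2)] u] x] by blast
  qed
  fix j assume j: "join_irreducible L j \<and> j \<squnion>\<^bsub>L\<^esub> x = u \<and> kappa L j \<sqinter>\<^bsub>L\<^esub> u = x"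
  then have jc: "j \<in> carrier L" by (simp add: join_irreducible_def)
  then obtain c f where cf: "c < f" "f \<le> c + int n" "B j = peak n c f"
    using join_irreducible_iff j by blast
  then have jl: "j = label c f"
    using B_inject[OF jc label_in[of c f]] B_label[of c f] by simp
  have "B j \<le> B u" using join_eq_iff[OF jc x u] j by blast
  then have fc: "f \<le> B u c" unfolding cf(3) peak_le_iff[OF bu n] .
  have "kappa L (label c f) \<sqinter>\<^bsub>L\<^esub> u = x" using j unfolding jl by blast
  then have "B x = (\<lambda>z. min (pit n c f z) (B u z))"
    using B_meet[OF kap(1)[OF cf(1,2)] u] unfolding kap(2)[OF cf(1,2)] by metis
  then have xc: "B x c = f - 1" using pit_at[OF cf(1), of n] fc by simp
  have d: "int n dvd c - a"
  proof (rule ccontr)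
    assume "\<not> int n dvd c - a"
    then have "B x c = B u c" using Bx by (simp add: set_class_off)
    then show False using xc fc by simp
  qed
  then have "f = e + (c - a)" using xc Bx by (simp add: set_class_def)
  moreover from d obtain k where "c - a = int n * k" by (elim dvdE)
  ultimately have "c = a + k * int n" "f = e + k * int n" by (simp_all add: algebra_simps)
  then show "j = label a e" using jl by (simp add: label_def peak_shift)
qed

lemma down_labels_eq:
  assumes u: "u \<in> carrier L"
  shows "down_labels L u = (\<lambda>(a, e). label a e) ` down_arcs n (B u)"
proof (intro equalityI subsetI)
  fix j assume "j \<in> down_labels L u"
  then obtain x where x: "covered_by L x u" "j = cover_label L x u" by (auto simp: down_labels_def)
  then have xc: "x \<in> carrier L" by (simp add: covered_by_def)
  obtain a e where ae: "(a, e) \<in> down_arcs n (B u)" "B x = set_class n (B u) a (e - 1)"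
    using covered_by_lowered[OF xc u] x(1) by blast
  have "j = label a e" unfolding x(2) by (rule cover_label_lowered[OF xc u ae])
  then show "j \<in> (\<lambda>(a, e). label a e) ` down_arcs n (B u)"
    by (intro image_eqI[OF _ ae(1)]) simp
next
  fix j assume "j \<in> (\<lambda>(a, e). label a e) ` down_arcs n (B u)"
  then obtain a e where ae: "(a, e) \<in> down_arcs n (B u)" "j = label a e" by auto
  let ?x = "tito_of n (set_class n (B u) a (e - 1))"
  have x: "?x \<in> carrier L" "B ?x = set_class n (B u) a (e - 1)"
    using tito_of_in B_tito_of bracket_lowered[OF B_bracket[OF u] n ae(1)] by blast+
  then have "covered_by L ?x u" using covered_by_lowered[OF x(1) u] ae(1) by blast
  moreover have "cover_label L ?x u = j" using cover_label_lowered[OF x(1) u ae(1) x(2)] ae(2) by simp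
  ultimately show "j \<in> down_labels L u" unfolding down_labels_def by blast
qed

lemma up_labels_eq:
  assumes u: "u \<in> carrier L"
  shows "up_labels L u = (\<lambda>(a, e). label a e) ` up_arcs n (B u)"
proof (intro equalityI subsetI)
  fix j assume "j \<in> up_labels L u"
  then obtain y where y: "covered_by L u y" "j = cover_label L u y" by (auto simp: up_labels_def)
  then have yc: "y \<in> carrier L" by (simp add: covered_by_def)
  obtain a e where ae: "(a, e) \<in> down_arcs n (B y)" "B u = set_class n (B y) a (e - 1)"
    using covered_by_lowered[OF u yc] y by blast
  have "j = label a e" unfolding y(2) by (rule cover_label_lowered[OF u yc ae])
  moreover have "(a, e) \<in> up_arcs n (B u)"
    using up_arc_of_lowered[OF B_bracket[OF u] n B_bracket[OF yc] ae] .
  ultimately show "j \<in> (\<lambda>(a, e). label a e) ` up_arcs n (B u)" 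
    by (intro image_eqI[of _ _ "(a, e)"]) simp_all
next
  fix j assume "j \<in> (\<lambda>(a, e). label a e) ` up_arcs n (B u)"
  then obtain a e where ae: "(a, e) \<in> up_arcs n (B u)" "j = label a e" by auto
  obtain v where v: "bracket n v" "(a, e) \<in> down_arcs n v" "B u = set_class n v a (e - 1)"
    using up_arc_imp_raised[OF B_bracket[OF u] n ae(1)] by blast
  have y: "tito_of n v \<in> carrier L" "B (tito_of n v) = v" using tito_of_in B_tito_of v(1) by blast+
  have "covered_by L u (tito_of n v)"
    using covered_by_lowered[OF u y(1)] v(2,3) unfolding y(2) by blast
  moreover have "cover_label L u (tito_of n v) = j"
    using cover_label_lowered[OF u y(1)] v(2,3) unfolding y(2) ae(2) by blast
  ultimately show "j \<in> up_labels L u" unfolding up_labels_def by blast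
qed

end

section \<open>Rowmotion as rotation of words\<close>

lemma periodic_multiple:
  fixes w :: "int \<Rightarrow> bool"
  assumes "\<And>j. w (j + p) = w j"
  shows "w (j + m * p) = w j"
proof -
  have nat: "w (j + int i * p) = w j" for i j
  proof (induction i)
    case (Suc i)
    then show ?case using assms[of "j + int i * p"] by (simp add: algebra_simps)
  qed simp
  show ?thesis
  proof (cases "m \<ge> 0")
    case True then show ?thesis using nat[of j "nat m"] by simp
  next
    case False then show ?thesis using nat[of "j + m * p" "nat (-m)"] by simp
  qed
qed

lemma words_shift:
  assumes w: "w \<in> words n" and n: "n > 0"
  shows "(\<lambda>j. w (j + k)) \<in> words n"
proof -
  have per: "w (j + 2 * int n) = w j" for j using w by (simp add: words_def)
  have mod: "w (j mod (2 * int n)) = w j" for j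
    using periodic_multiple[of w "2 * int n" "j mod (2 * int n)" "j div (2 * int n)"] per
    unfolding mod_div_mult_eq by simp
  have "bij_betw (\<lambda>j. (j + k) mod (2 * int n)) {j \<in> {0..<2 * int n}. w (j + k)} {j \<in> {0..<2 * int n}. w j}"
  proof (rule bij_betw_byWitness[where f' = "\<lambda>j. (j - k) mod (2 * int n)"])
    have "w ((j - k) mod (2 * int n) + k) = w j" for j
    proof -
      have "((j - k) mod (2 * int n) + k) mod (2 * int n) = j mod (2 * int n)"
        by (simp add: mod_add_left_eq)
      then show ?thesis using mod by metis
    qed
    then show "(\<lambda>j. (j - k) mod (2 * int n)) ` {j \<in> {0..<2 * int n}. w j} \<subseteq> {j \<in> {0..<2 * int n}. w (j + k)}"
      using n by auto
    show "(\<lambda>j. (j + k) mod (2 * int n)) ` {j \<in> {0..<2 * int n}. w (j + k)} \<subseteq> {j \<in> {0..<2 * int n}. w j}"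
      using n mod by auto
  qed (auto simp: mod_diff_left_eq mod_add_left_eq)
  then have "card {j \<in> {0..<2 * int n}. w (j + k)} = n"
    using w by (simp add: bij_betw_same_card words_def)
  moreover have "w (j + 2 * int n + k) = w (j + k)" for j
    using per[of "j + k"] by (simp add: algebra_simps)
  ultimately show ?thesis by (simp add: words_def)
qed

lemma words_periodic_multiple:
  assumes "w \<in> words n" shows "w (j + 2 * int n * m) = w j"
  using periodic_multiple[of w "2 * int n" j m] assms by (simp add: words_def mult.commute)

lemma bracket_eq_if_up_arcs_eq:
  assumes u: "bracket n u" and v: "bracket n v" and n: "n > 0" and "up_arcs n u = up_arcs n v"
  shows "u = v"
proof (rule word_inj[OF u v n], rule ext)
  fix j
  have "opens n u i \<longleftrightarrow> opens n v i" for i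
    using up_arcs_iff[of i _ n u] up_arcs_iff[of i _ n v] assms(4) by blast
  moreover have "i < u i \<longleftrightarrow> i < v i" for i
    using fixed_iff_up_arc[OF u n, of i] fixed_iff_up_arc[OF v n, of i] assms(4)
      bracket_ge[OF u n, of i] bracket_ge[OF v n, of i] by auto
  ultimately show "word n u j = word n v j" by (simp add: word_def)
qed

context cyclic_tamari
begin

definition encode :: "int rel \<Rightarrow> int \<Rightarrow> bool" where
  "encode r = word n (B r)"

lemma bij_encode: "bij_betw encode (carrier L) (words n)"
  using bij_betw_trans[OF bij_bracket_of[OF n] bij_word[OF n]]
  by (simp add: encode_def[abs_def] comp_def)

text \<open>The rotation of words, transported back to orders along the bijection \<open>encode\<close>.\<close>

definition rotate_order :: "int \<Rightarrow> int rel \<Rightarrow> int rel" where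
  "rotate_order k r = inv_into (carrier L) encode (\<lambda>j. encode r (j + k))"

lemma encode_in: "r \<in> carrier L \<Longrightarrow> encode r \<in> words n"
  using bij_betw_apply[OF bij_encode] .

lemma encode_inject: "r \<in> carrier L \<Longrightarrow> s \<in> carrier L \<Longrightarrow> encode r = encode s \<longleftrightarrow> r = s"
  using bij_encode by (auto simp: bij_betw_def inj_on_def)

lemma rotate_order_in: "r \<in> carrier L \<Longrightarrow> rotate_order k r \<in> carrier L"
  and encode_rotate_order: "r \<in> carrier L \<Longrightarrow> encode (rotate_order k r) = (\<lambda>j. encode r (j + k))"
proof -
  assume r: "r \<in> carrier L"
  have *: "(\<lambda>j. encode r (j + k)) \<in> encode ` carrier L"
    using words_shift[OF encode_in[OF r] n] bij_encode by (simp add: bij_betw_def)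
  show "rotate_order k r \<in> carrier L" unfolding rotate_order_def by (rule inv_into_into[OF *])
  show "encode (rotate_order k r) = (\<lambda>j. encode r (j + k))" unfolding rotate_order_def by (rule f_inv_into_f[OF *])
qed

lemma rotate_order_eqI:
  assumes "r \<in> carrier L" "s \<in> carrier L" "\<And>j. encode s j = encode r (j + k)"
  shows "rotate_order k r = s"
  using encode_inject[OF rotate_order_in[OF assms(1)] assms(2)] encode_rotate_order[OF assms(1)] assms(3) by auto

lemma rotate_order_add: "r \<in> carrier L \<Longrightarrow> rotate_order (k + l) r = rotate_order k (rotate_order l r)"
  by (rule rotate_order_eqI) (simp_all add: rotate_order_in encode_rotate_order algebra_simps)

lemma rotate_order_cong:
  assumes "r \<in> carrier L" "2 * int n dvd k - l" shows "rotate_order k r = rotate_order l r"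
proof (rule rotate_order_eqI)
  fix j
  obtain m where m: "k - l = 2 * int n * m" using assms(2) by (elim dvdE)
  have "encode r (j + l + 2 * int n * m) = encode r (j + l)"
    by (rule words_periodic_multiple[OF encode_in[OF assms(1)]])
  then show "encode (rotate_order l r) j = encode r (j + k)"
    using m by (simp add: encode_rotate_order[OF assms(1)] algebra_simps flip: m)
qed (use assms rotate_order_in in auto)

lemma rotate_order_0: "r \<in> carrier L \<Longrightarrow> rotate_order 0 r = r"
  by (rule rotate_order_eqI) simp_all

lemma bij_rotate_order: "bij_betw (rotate_order k) (carrier L) (carrier L)"
proof (rule bij_betw_byWitness[where f' = "rotate_order (-k)"])
  show "\<forall>r\<in>carrier L. rotate_order (- k) (rotate_order k r) = r"
    using rotate_order_add[of _ "-k" k] rotate_order_0 by simp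
  show "\<forall>r\<in>carrier L. rotate_order k (rotate_order (- k) r) = r"
    using rotate_order_add[of _ k "-k"] rotate_order_0 by simp
qed (use rotate_order_in in auto)

text \<open>A peak determines its arc up to translation, and the up arcs determine the word. This is what
  makes the map in the definition of rowmotion unique.\<close>

lemma up_labels_inject:
  assumes r: "r \<in> carrier L" and s: "s \<in> carrier L" and eq: "up_labels L r = up_labels L s"
  shows "r = s"
proof -
  have arc: "a < e" "e \<le> a + int n" if "(a, e) \<in> up_arcs n u" "bracket n u" for a e u
    using that bracket_ge[OF that(2) n, of a] by (auto simp: up_arcs_def)
  have sub: "(a, e) \<in> up_arcs n (B s)"
    if rs: "r \<in> carrier L" "s \<in> carrier L" "up_labels L r = up_labels L s" and ae: "(a, e) \<in> up_arcs n (B r)" 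
    for r s a e
  proof -
    have "label a e \<in> up_labels L s" using ae up_labels_eq[OF rs(1)] rs(3) by force
    then obtain b f where bf: "(b, f) \<in> up_arcs n (B s)" "label a e = label b f"
      unfolding up_labels_eq[OF rs(2)] by auto
    note bA = arc[OF ae B_bracket[OF rs(1)]] and bB = arc[OF bf(1) B_bracket[OF rs(2)]]
    have "peak n a e = peak n b f" using bf(2) B_label[of a e] B_label[of b f] bA bB by simp
    then obtain k where "b = a + k * int n" "f = e + k * int n" using peak_inj bA(1) bB(1) by blast
    then show ?thesis using bf(1) up_arcs_shift[OF B_bracket[OF rs(2)] n] by simp
  qed
  have "up_arcs n (B r) = up_arcs n (B s)"
    using sub[OF r s eq] sub[OF s r eq[symmetric]] by auto
  then have "B r = B s" by (rule bracket_eq_if_up_arcs_eq[OF B_bracket[OF r] B_bracket[OF s] n])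
  then show ?thesis using B_inject[OF r s] by blast
qed

lemma down_labels_eq_up_labels_rotate_order:
  assumes r: "r \<in> carrier L" shows "down_labels L r = up_labels L (rotate_order 1 r)"
proof -
  let ?s = "tito_of n (bracket_row n (B r))"
  note br = bracket_bracket_row[OF B_bracket[OF r] n]
  have s: "?s \<in> carrier L" "B ?s = bracket_row n (B r)" using tito_of_in[OF br] B_tito_of[OF br] .
  have "rotate_order 1 r = ?s"
    using word_row[OF B_bracket[OF r] n] by (intro rotate_order_eqI r s(1)) (simp add: encode_def s(2))
  then show ?thesis
    unfolding down_labels_eq[OF r] using up_labels_eq[OF s(1)] up_arcs_row[OF B_bracket[OF r] n]
    by (simp add: s(2))
qed

theorem rowmotion_eq_rotate_order: "rowmotion L = restrict (rotate_order 1) (carrier L)"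
  unfolding rowmotion_def
proof (rule the_equality, intro conjI ballI)
  show "restrict (rotate_order 1) (carrier L) \<in> extensional (carrier L)" by simp
  show "bij_betw (restrict (rotate_order 1) (carrier L)) (carrier L) (carrier L)"
    using bij_rotate_order[of 1] by (simp cong: bij_betw_cong)
  show "down_labels L u = up_labels L (restrict (rotate_order 1) (carrier L) u)" if "u \<in> carrier L" for u
    using down_labels_eq_up_labels_rotate_order that by simp
  fix f assume f: "f \<in> extensional (carrier L) \<and> bij_betw f (carrier L) (carrier L) \<and>
     (\<forall>u\<in>carrier L. down_labels L u = up_labels L (f u))"
  show "f = restrict (rotate_order 1) (carrier L)"
  proof (rule extensionalityI[of _ "carrier L"])
    fix u assume u: "u \<in> carrier L"
    have "up_labels L (f u) = up_labels L (rotate_order 1 u)"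
      using f u down_labels_eq_up_labels_rotate_order[OF u] by metis
    moreover have "f u \<in> carrier L" using f u bij_betw_apply by metis
    ultimately show "f u = restrict (rotate_order 1) (carrier L) u"
      using up_labels_inject[OF _ rotate_order_in[OF u]] u by simp
  qed (use f in auto)
qed

end

section \<open>Words fixed by a rotation\<close>

lemma periodic_gcd:
  fixes w :: "int \<Rightarrow> bool"
  shows "(\<forall>j. w (j + gcd p q) = w j) \<longleftrightarrow> (\<forall>j. w (j + p) = w j) \<and> (\<forall>j. w (j + q) = w j)"
proof (rule iffI)
  assume g: "\<forall>j. w (j + gcd p q) = w j"
  have "w (j + p) = w j" "w (j + q) = w j" for j
    using periodic_multiple[of w "gcd p q" j "p div gcd p q"] periodic_multiple[of w "gcd p q" j "q div gcd p q"] g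
    by simp_all
  then show "(\<forall>j. w (j + p) = w j) \<and> (\<forall>j. w (j + q) = w j)" by blast
next
  assume pq: "(\<forall>j. w (j + p) = w j) \<and> (\<forall>j. w (j + q) = w j)"
  show "\<forall>j. w (j + gcd p q) = w j"
  proof
    fix j
    obtain a b where "a * p + b * q = gcd p q" using bezout_int by blast
    then have "w (j + gcd p q) = w (j + b * q + a * p)" by (simp add: algebra_simps)
    also have "\<dots> = w j" using periodic_multiple[of w p] periodic_multiple[of w q] pq by simp
    finally show "w (j + gcd p q) = w j" .
  qed
qed

lemma card_periodic:
  fixes w :: "int \<Rightarrow> bool" and d c :: nat
  assumes "\<And>j. w (j + int d) = w j"
  shows "card {j \<in> {0..<int (d * c)}. w j} = c * card {j \<in> {0..<int d}. w j}"
proof (induction c)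
  case (Suc c)
  have eq: "{j \<in> {0..<int (d * Suc c)}. w j} =
     {j \<in> {0..<int (d * c)}. w j} \<union> (\<lambda>j. j + int c * int d) ` {j \<in> {0..<int d}. w j}" (is "?A = ?B \<union> ?C")
  proof (intro Set.set_eqI iffI)
    fix j assume j: "j \<in> ?A"
    show "j \<in> ?B \<union> ?C"
    proof (cases "j < int (d * c)")
      case False
      then have "j - int c * int d \<in> {j \<in> {0..<int d}. w j}"
        using j periodic_multiple[of w "int d" "j - int c * int d" "int c"] assms 
        by (simp add: algebra_simps)
      then show ?thesis by (force simp: image_iff)
    qed (use j in simp)
  next
    fix j assume "j \<in> ?B \<union> ?C"
    then show "j \<in> ?A"
      using periodic_multiple[of w "int d" _ "int c"] assms by (auto simp: algebra_simps)
  qed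
  have "card (?B \<union> ?C) = card ?B + card ?C"
  proof (rule card_Un_disjoint)
    show "finite ?B" by (rule finite_subset[of _ "{0..<int (d * c)}"]) auto
    show "finite ?C" by (rule finite_imageI, rule finite_subset[of _ "{0..<int d}"]) auto
    show "?B \<inter> ?C = {}" by (auto simp: mult.commute)
  qed
  also have "card ?C = card {j \<in> {0..<int d}. w j}" by (rule card_image) (simp add: inj_on_def)
  finally show ?case unfolding eq using Suc by simp
qed simp

text \<open>By Bezout's identity, period \<open>2n\<close> and invariance under the shift by \<open>k\<close> amount to period
  \<open>g = gcd(k, 2n)\<close>. Such a word is a subset of \<open>{0..<g}\<close>, and it is repeated \<open>d = 2n / g\<close> times
  within \<open>2n\<close> letters.\<close>

lemma card_periodic_words:
  fixes k :: int and n :: nat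
  assumes n: "n > 0"
  defines "d \<equiv> nat (2 * int n div gcd k (2 * int n))"
  shows "card {w \<in> words n. \<forall>j. w (j + k) = w j} = 
    (if d dvd n then (2 * n div d) choose (n div d) else 0)"
proof -
  define g where "g = nat (gcd k (2 * int n))"
  have g: "int g = gcd k (2 * int n)" by (simp add: g_def)
  have gd: "2 * n = g * d" 
  proof -
    have "int g * int d = 2 * int n" using n by (simp add: g d_def pos_imp_zdiv_nonneg_iff)
    then show ?thesis by (metis of_nat_eq_iff of_nat_mult of_nat_numeral)
  qed
  have pos: "g > 0" "d > 0" using gd n by (auto intro!: Nat.gr0I)
  let ?X = "{w \<in> words n. \<forall>j. w (j + k) = w j}"
  let ?Y = "{B. B \<subseteq> {0..<int g} \<and> d * card B = n}"
  have X: "w \<in> ?X \<longleftrightarrow> (\<forall>j. w (j + int g) = w j) \<and> d * card {j \<in> {0..<int g}. w j} = n" for w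
  proof -
    have "2 * int n = int (g * d)" using gd by (metis of_nat_mult of_nat_numeral)
    then have "(\<forall>j. w (j + int g) = w j) \<Longrightarrow>
        card {j \<in> {0..<2 * int n}. w j} = d * card {j \<in> {0..<int g}. w j}"
      using card_periodic[of w g d] by simp
    moreover have "w \<in> ?X \<longleftrightarrow> ((\<forall>j. w (j + k) = w j) \<and> (\<forall>j. w (j + 2 * int n) = w j)) \<and>
        card {j \<in> {0..<2 * int n}. w j} = n"
      unfolding words_def mem_Collect_eq by blast
    ultimately show ?thesis unfolding periodic_gcd[symmetric] g[symmetric]
      by (cases "\<forall>j. w (j + int g) = w j") (simp_all only: simp_thms)
  qed
  have "bij_betw (\<lambda>w. {j \<in> {0..<int g}. w j}) ?X ?Y"
  proof (rule bij_betw_byWitness[where f' = "\<lambda>B j. j mod int g \<in> B"])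
    show "\<forall>w\<in>?X. (\<lambda>j. j mod int g \<in> {j \<in> {0..<int g}. w j}) = w"
    proof
      fix w assume "w \<in> ?X"
      then have "\<And>j. w (j + int g) = w j" using X by blast
      then have "w (j mod int g) = w j" for j
        using periodic_multiple[of w "int g" "j mod int g" "j div int g"] by simp
      then show "(\<lambda>j. j mod int g \<in> {j \<in> {0..<int g}. w j}) = w" using pos by auto
    qed
    have B: "{j \<in> {0..<int g}. j mod int g \<in> B} = B" if "B \<subseteq> {0..<int g}" for B
      using that by force
    then show "\<forall>B\<in>?Y. {j \<in> {0..<int g}. j mod int g \<in> B} = B" by blast
    show "(\<lambda>w. {j \<in> {0..<int g}. w j}) ` ?X \<subseteq> ?Y"
    proof (rule image_subsetI)
      fix w assume "w \<in> ?X"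
      then show "{j \<in> {0..<int g}. w j} \<in> ?Y" unfolding X by auto
    qed
    show "(\<lambda>B j. j mod int g \<in> B) ` ?Y \<subseteq> ?X"
    proof (rule image_subsetI)
      fix B assume "B \<in> ?Y"
      then have BY: "B \<subseteq> {0..<int g}" "d * card B = n" by auto
      show "(\<lambda>j. j mod int g \<in> B) \<in> ?X" unfolding X B[OF BY(1)] using BY(2) by simp
    qed
  qed
  then have card: "card ?X = card ?Y" by (rule bij_betw_same_card)
  show ?thesis
  proof (cases "d dvd n")
    case True
    then have "?Y = {B. B \<subseteq> {0..<int g} \<and> card B = n div d}" using pos by auto
    then have "card ?Y = g choose (n div d)" using n_subsets[of "{0..<int g}" "n div d"] by simp
    then show ?thesis using card True gd pos by simp
  next
    case False
    then have "?Y = {}" by auto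
    then show ?thesis using card False by (simp only: card.empty if_False)
  qed
qed

text \<open>The words fixed by the trivial rotation are all words, and their number is positive.\<close>

lemma finite_words: "n > 0 \<Longrightarrow> finite (words n)"
  using card_periodic_words[of n 0] by (intro card_ge_0_finite) simp

section \<open>The type B Catalan polynomial at roots of unity\<close>

text \<open>Gaussian binomial coefficients are polynomials. This is their Pascal recurrence, written without
  quotients.\<close>

lemma gauss_prod_dvd:
  fixes y :: "'a::comm_ring_1"
  shows "(\<Prod>i=1..k. y ^ i - 1) dvd (\<Prod>i=1..k. y ^ (m + i) - 1)"
proof (induction "m + k" arbitrary: m k rule: less_induct)
  case less
  show ?case
  proof (cases "m = 0 \<or> k = 0")
    case True
    then show ?thesis by auto
  next
    case False
    then obtain m' k' where mk: "m = Suc m'" "k = Suc k'" by (metis not0_implies_Suc)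
    let ?F = "\<lambda>m k. \<Prod>i=1..k. y ^ (m + i) - 1"
    have shift: "?F m k' * (y ^ m - 1) = ?F m' k"
    proof -
      have "?F m' k = (\<Prod>i=0..k'. y ^ (m + i) - 1)"
        using prod.shift_bounds_cl_Suc_ivl[of "\<lambda>i. y ^ (m' + i) - 1" 0 k'] by (simp add: mk)
      also have "\<dots> = ?F m k' * (y ^ m - 1)"
        by (simp add: prod.atLeast0_atMost_Suc_shift prod.atLeast_Suc_atMost[of 0] mult.commute)
      finally show ?thesis by simp
    qed
    have "?F m k = ?F m k' * (y ^ (m + k) - 1)" by (simp add: mk)
    also have "y ^ (m + k) - 1 = y ^ k * (y ^ m - 1) + (y ^ k - 1)"
      by (simp add: power_add algebra_simps)
    also have "?F m k' * \<dots> = y ^ k * ?F m' k + ?F m k' * (y ^ k - 1)"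
      unfolding shift[symmetric] by (simp add: algebra_simps)
    finally have eq: "?F m k = y ^ k * ?F m' k + ?F m k' * (y ^ k - 1)" .
    have "(\<Prod>i=1..k. y ^ i - 1) dvd ?F m' k" by (rule less) (simp add: mk)
    moreover have "(\<Prod>i=1..k'. y ^ i - 1) dvd ?F m k'" by (rule less) (simp add: mk)
    then have "(\<Prod>i=1..k. y ^ i - 1) dvd ?F m k' * (y ^ k - 1)"
      by (simp add: mk mult_dvd_mono)
    ultimately show ?thesis unfolding eq by simp
  qed
qed

lemma q_int_ratio:
  "q_int a / q_int b = Fract (Polynomial.monom 1 a - 1) (Polynomial.monom 1 b - 1)" if "b > 0"
proof -
  have 1: "Polynomial.monom 1 k - 1 \<noteq> (0 :: complex poly)" if "k > 0" for k
  proof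
    assume "Polynomial.monom 1 k - 1 = (0 :: complex poly)"
    then have "Polynomial.coeff (Polynomial.monom 1 k - 1 :: complex poly) k = 0" by simp
    then show False using that by (simp add: one_pCons coeff_pCons split: nat.splits)
  qed
  show ?thesis using 1[of 1] 1[of b] that
    by (simp add: q_int_def eq_fract)
qed

lemma Cat_B_product:
  "Cat_B n * (\<Prod>i=1..n. Polynomial.monom 1 2 ^ i - 1) = (\<Prod>i=1..n. Polynomial.monom 1 2 ^ (n + i) - 1)"
proof -
  let ?y = "Polynomial.monom 1 2 :: complex poly"
  let ?D = "\<Prod>i=1..n. ?y ^ i - 1" and ?N = "\<Prod>i=1..n. ?y ^ (n + i) - 1"
  have pw: "?y ^ i = Polynomial.monom 1 (2 * i)" for i by (simp add: monom_power)
  have nz: "?y ^ i - 1 \<noteq> 0" if "i > 0" for i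
  proof
    assume "?y ^ i - 1 = 0"
    then have "Polynomial.coeff (?y ^ i - 1) (2 * i) = 0" by simp
    then show False using that by (simp add: pw one_pCons coeff_pCons split: nat.splits)
  qed
  then have D: "?D \<noteq> 0" by simp
  obtain p where p: "?N = ?D * p" using gauss_prod_dvd[of ?y n n] by (elim dvdE)
  have frac: "(\<Prod>i = 1..n. q_int (2 * n + 2 * i) / q_int (2 * i)) = Fract ?N ?D"
  proof -
    have "(\<Prod>i = 1..n. q_int (2 * n + 2 * i) / q_int (2 * i))
       = (\<Prod>i = 1..n. Fract (?y ^ (n + i) - 1) (?y ^ i - 1))"
      by (intro prod.cong) (auto simp: q_int_ratio pw distrib_left)
    also have "\<dots> = Fract ?N ?D"
    proof -
      have "(\<Prod>i = 1..m. Fract (?y ^ (n + i) - 1) (?y ^ i - 1)) = 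
        Fract (\<Prod>i = 1..m. ?y ^ (n + i) - 1) (\<Prod>i = 1..m. ?y ^ i - 1)" for m
        by (induction m) (simp_all add: One_fract_def)
      then show ?thesis .
    qed
    finally show ?thesis .
  qed
  have "Cat_B n = p"
    unfolding Cat_B_def frac
  proof (rule the_equality)
    show "Fract p 1 = Fract ?N ?D" using D p by (simp add: eq_fract mult.commute)
  next
    fix p' assume "Fract p' 1 = Fract ?N ?D"
    then have "p' * ?D = p * ?D" using D p by (simp add: eq_fract mult.commute)
    then show "p' = p" using D by simp
  qed
  then show ?thesis using p by (simp add: mult.commute)
qed

lemma prod_power_multiples:
  fixes c :: "'a::comm_monoid_mult" assumes "d > 0"
  shows "(\<Prod>i=1..m. if d dvd i then c else 1) = c ^ (m div d)"
proof (induction m)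
  case (Suc m)
  then show ?case by (simp add: div_Suc mod_eq_0_iff_dvd mult.commute)
qed simp

lemma prod_fact_multiples:
  fixes f :: "nat \<Rightarrow> complex" assumes "d > 0"
  shows "(\<Prod>i=1..m. if d dvd i then of_nat (i div d) else f i) =
    fact (m div d) * (\<Prod>i=1..m. if d dvd i then 1 else f i)"
proof (induction m)
  case (Suc m)
  then show ?case by (simp add: div_Suc mod_eq_0_iff_dvd algebra_simps)
qed simp

lemma prod_double:
  fixes f :: "nat \<Rightarrow> 'a::comm_monoid_mult"
  shows "(\<Prod>i=1..2 * n. f i) = (\<Prod>i=1..n. f i) * (\<Prod>i=1..n. f (n + i))"
proof -
  have "(\<Prod>i=1..n + n. f i) = (\<Prod>i=1..n. f i) * (\<Prod>i=n + 1..n + n. f i)"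
    by (rule prod.ub_add_nat) simp
  also have "(\<Prod>i=n + 1..n + n. f i) = (\<Prod>i=1..n. f (n + i))"
    using prod.shift_bounds_cl_nat_ivl[of f 1 n n] by (simp add: add.commute)
  finally show ?thesis by (simp add: mult_2)
qed

text \<open>Multiplying twice by the denominator yields a product over \<open>1..2n\<close>, so numerator and denominator
  are products of the same kind. Write \<open>y = q\<^sup>2\<close> and \<open>y\<^sup>i - 1 = r i * (y\<^sup>d - 1)\<close> if \<open>d\<close> divides \<open>i\<close>, and
  \<open>y\<^sup>i - 1 = r i\<close> otherwise. The factors \<open>r i\<close> do not vanish at the given point, where those
  with \<open>d\<close> dividing \<open>i\<close> take the value \<open>i / d\<close>; they produce factorials. What is left is a power
  of \<open>y\<^sup>d - 1\<close> with exponent \<open>2n div d - 2 (n div d)\<close>, which is zero exactly if \<open>d\<close> divides \<open>n\<close>.\<close>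

lemma poly_Cat_B_root_of_unity:
  fixes q :: complex
  assumes d: "d > 0" and ord: "\<And>i. (q\<^sup>2) ^ i = 1 \<longleftrightarrow> d dvd i" and dvd: "d dvd 2 * n"
  shows "poly (Cat_B n) q = (if d dvd n then of_nat ((2 * n div d) choose (n div d)) else 0)"
proof -
  let ?y = "Polynomial.monom 1 2 :: complex poly"
  define z where "z = q\<^sup>2"
  have y: "poly ?y q = z" by (simp add: poly_monom z_def)
  define r where "r i = (if d dvd i then \<Sum>j<i div d. (?y ^ d) ^ j else ?y ^ i - 1)" for i
  define R where "R m = (\<Prod>i=1..m. r i)" for m
  have split: "?y ^ i - 1 = r i * (if d dvd i then ?y ^ d - 1 else 1)" for i
  proof (cases "d dvd i")
    case True
    then have "?y ^ i = (?y ^ d) ^ (i div d)" by (simp flip: power_mult)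
    then show ?thesis using True power_diff_1_eq[of "?y ^ d" "i div d"] by (simp add: r_def mult.commute)
  qed (simp add: r_def)
  have facs: "(\<Prod>i=1..m. ?y ^ i - 1) = R m * (?y ^ d - 1) ^ (m div d)" for m
  proof -
    have "(\<Prod>i=1..m. ?y ^ i - 1) = (\<Prod>i=1..m. r i * (if d dvd i then ?y ^ d - 1 else 1))"
      by (rule prod.cong[OF refl split])
    then show ?thesis unfolding R_def prod.distrib prod_power_multiples[OF d] .
  qed
  have all: "Cat_B n * (\<Prod>i=1..n. ?y ^ i - 1) * (\<Prod>i=1..n. ?y ^ i - 1) = (\<Prod>i=1..2 * n. ?y ^ i - 1)"
  proof -
    have "(\<Prod>i=1..2 * n. ?y ^ i - 1) = (\<Prod>i=1..n. ?y ^ i - 1) * (\<Prod>i=1..n. ?y ^ (n + i) - 1)"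
      by (rule prod_double)
    then show ?thesis using Cat_B_product[of n] by (simp add: mult.commute)
  qed
  have nz: "?y ^ d - 1 \<noteq> 0"
  proof
    assume "?y ^ d - 1 = 0"
    then have "Polynomial.coeff (?y ^ d - 1) (2 * d) = 0" by simp
    then show False using d by (simp add: monom_power one_pCons coeff_pCons split: nat.splits)
  qed
  define a where "a = n div d"
  define c where "c = 2 * n div d"
  have c: "2 * n = d * c" using dvd by (simp add: c_def)
  have "2 * (d * a) \<le> d * c" using c by (metis a_def mult_le_mono2 times_div_less_eq_dividend)
  then have ac: "2 * a \<le> c" using d by simp
  have "Cat_B n * R n * R n * (?y ^ d - 1) ^ (2 * a) = R (2 * n) * (?y ^ d - 1) ^ (c - 2 * a) * (?y ^ d - 1) ^ (2 * a)"
  proof -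
    have "(?y ^ d - 1) ^ c = (?y ^ d - 1) ^ (c - 2 * a) * (?y ^ d - 1) ^ (2 * a)"
      using ac by (simp flip: power_add)
    moreover have "(?y ^ d - 1) ^ (2 * a) = (?y ^ d - 1) ^ a * (?y ^ d - 1) ^ a"
      by (simp add: mult_2 power_add)
    ultimately show ?thesis
      using all unfolding facs a_def[symmetric] c_def[symmetric] by (simp only: mult_ac)
  qed
  then have main: "Cat_B n * R n * R n = R (2 * n) * (?y ^ d - 1) ^ (c - 2 * a)"
    using nz by simp
  define Z where "Z m = (\<Prod>i=1..m. if d dvd i then 1 else z ^ i - 1)" for m
  have Rq: "poly (R m) q = fact (m div d) * Z m" for m
  proof -
    have "poly (R m) q = (\<Prod>i=1..m. poly (r i) q)" by (simp add: R_def poly_prod)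
    also have "\<dots> = (\<Prod>i=1..m. if d dvd i then of_nat (i div d) else z ^ i - 1)"
    proof (intro prod.cong refl)
      fix i
      have "z ^ d = 1" using ord[of d] by (simp add: z_def)
      then show "poly (r i) q = (if d dvd i then of_nat (i div d) else z ^ i - 1)"
        by (simp add: r_def poly_sum y)
    qed
    finally show ?thesis unfolding Z_def prod_fact_multiples[OF d] .
  qed
  have Z: "Z m \<noteq> 0" for m using ord by (simp add: Z_def z_def)
  have ev: "poly (Cat_B n) q * (fact a * Z n) * (fact a * Z n) = fact c * Z (2 * n) * 0 ^ (c - 2 * a)"
  proof -
    have "poly (?y ^ d - 1) q = 0" using ord[of d] by (simp add: y z_def)
    then show ?thesis
      using arg_cong[OF main, of "\<lambda>p. poly p q"] unfolding poly_mult poly_power Rq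
      by (simp only: a_def c_def)
  qed
  show ?thesis
  proof (cases "d dvd n")
    case True
    then have n: "n = d * a" by (simp add: a_def)
    then have c2: "c = 2 * a" using c d by simp
    have zn: "z ^ n = 1" using ord[of n] True by (simp add: z_def)
    have "Z (2 * n) = Z n * (\<Prod>i=1..n. if d dvd n + i then 1 else z ^ (n + i) - 1)"
      unfolding Z_def by (rule prod_double)
    also have "(\<Prod>i=1..n. if d dvd n + i then 1 else z ^ (n + i) - 1) = Z n"
      unfolding Z_def using True zn by (intro prod.cong) (simp_all add: power_add dvd_add_right_iff)
    finally have "poly (Cat_B n) q * (fact a * fact a) * (Z n * Z n) = fact c * (Z n * Z n)"
      using ev c2 by (simp add: mult_ac)
    then have "poly (Cat_B n) q * (fact a * fact a) = fact (2 * a)" using Z c2 by simp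
    moreover have "of_nat (2 * a choose a) = (fact (2 * a) / (fact a * fact a) :: complex)"
      using binomial_fact[of a "2 * a"] by (simp add: mult_2)
    ultimately have "poly (Cat_B n) q * (fact a * fact a) = of_nat (c choose a) * (fact a * fact a)"
      unfolding c2 by simp
    then have "poly (Cat_B n) q = of_nat (c choose a)" by simp
    then show ?thesis using True by (simp add: a_def c_def)
  next
    case False
    have "c \<noteq> 2 * a"
    proof
      assume "c = 2 * a"
      then have "n = d * a" using c by simp
      then show False using False by simp
    qed
    then have "poly (Cat_B n) q * (fact a * Z n) * (fact a * Z n) = 0" using ev ac by simp
    then show ?thesis using Z False by simp
  qed
qed

lemma cis_eq_1_iff: "cis t = 1 \<longleftrightarrow> (\<exists>m::int. t = 2 * pi * of_int m)"
proof
  assume "cis t = 1"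
  then have "cos t = 1" by (metis cis.simps(1) one_complex.simps(1))
  then show "\<exists>m::int. t = 2 * pi * of_int m" by (auto simp: cos_one_2pi_int mult.commute)
next
  assume "\<exists>m::int. t = 2 * pi * of_int m"
  then show "cis t = 1" by (auto simp: cis_multiple_2pi)
qed

lemma root_of_unity_power_eq_1:
  fixes k :: int and N :: nat
  assumes N: "N > 0"
  shows "cis (2 * pi * of_int k / of_nat N) ^ i = 1 \<longleftrightarrow> nat (int N div gcd k (int N)) dvd i"
proof -
  define d where "d = gcd k (int N)"
  have d: "d > 0" using N by (simp add: d_def)
  obtain k' N' where k': "k = d * k'" "int N = d * N'"
    unfolding d_def by (metis gcd_dvd1 gcd_dvd2 dvdE)
  have cop: "coprime k' N'"
  proof (rule gcd_coprime)
    show "gcd k (int N) \<noteq> 0" using N by simp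
    show "k = k' * gcd k (int N)" "int N = N' * gcd k (int N)"
      using k' unfolding d_def by (simp_all only: mult.commute)
  qed
  have N': "N' > 0" using k' d N by (metis of_nat_0_less_iff zero_less_mult_pos)
  have "cis (2 * pi * of_int k / of_nat N) ^ i = 1 \<longleftrightarrow> 
      (\<exists>m::int. real i * (2 * pi * of_int k / of_nat N) = 2 * pi * of_int m)"
    by (simp only: DeMoivre cis_eq_1_iff)
  also have "\<dots> \<longleftrightarrow> (\<exists>m::int. real i * of_int k = of_nat N * of_int m)"
    using N by (simp add: field_simps)
  also have "\<dots> \<longleftrightarrow> (\<exists>m::int. int i * k = int N * m)"
    by (metis (mono_tags) of_int_eq_iff of_int_mult of_int_of_nat_eq)
  also have "\<dots> \<longleftrightarrow> int N dvd int i * k" by (simp add: dvd_def)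
  also have "\<dots> \<longleftrightarrow> N' dvd int i" 
  proof -
    have "int i * k = d * (int i * k')" using k' by simp
    then have "int N dvd int i * k \<longleftrightarrow> d * N' dvd d * (int i * k')" using k'(2) by (simp only:)
    then have "int N dvd int i * k \<longleftrightarrow> N' dvd int i * k'" using d by simp
    then show ?thesis using cop by (simp add: coprime_dvd_mult_left_iff coprime_commute)
  qed
  also have "\<dots> \<longleftrightarrow> nat N' dvd i" using N' by (simp add: nat_dvd_iff)
  also have "N' = int N div d" using k' d by simp
  finally show ?thesis by (simp add: d_def)
qed

section \<open>The cyclic sieving phenomenon\<close>

context cyclic_tamari
begin

lemma card_fixed_by_rotate_order:
  "card {r \<in> carrier L. rotate_order k r = r} = card {w \<in> words n. \<forall>j. w (j + k) = w j}"
proof -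
  have image: "encode ` {r \<in> carrier L. rotate_order k r = r} = {w \<in> words n. \<forall>j. w (j + k) = w j}"
  proof (intro equalityI subsetI)
    fix w assume "w \<in> encode ` {r \<in> carrier L. rotate_order k r = r}"
    then obtain r where "r \<in> carrier L" "rotate_order k r = r" "w = encode r" by blast
    then have "w \<in> words n" "(\<lambda>j. w (j + k)) = w" using encode_rotate_order[of r k] encode_in by simp_all
    then show "w \<in> {w \<in> words n. \<forall>j. w (j + k) = w j}" by (auto dest: fun_cong)
  next
    fix w assume w: "w \<in> {w \<in> words n. \<forall>j. w (j + k) = w j}"
    then obtain r where r: "r \<in> carrier L" "w = encode r" using bij_encode by (auto simp: bij_betw_def)
    then have "rotate_order k r = r" using w by (intro rotate_order_eqI) auto
    then show "w \<in> encode ` {r \<in> carrier L. rotate_order k r = r}" using r by blast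
  qed
  have "inj_on encode {r \<in> carrier L. rotate_order k r = r}"
    by (rule inj_on_subset[OF bij_betw_imp_inj_on[OF bij_encode]]) blast
  then have "card (encode ` {r \<in> carrier L. rotate_order k r = r}) = card {r \<in> carrier L. rotate_order k r = r}"
    by (rule card_image)
  then show ?thesis unfolding image by (rule HOL.sym)
qed

lemma card_fixed_by_rotate_order_eq_Cat_B:
  "of_nat (card {r \<in> carrier L. rotate_order k r = r}) =
     poly (Cat_B n) (exp (2 * of_real pi * \<i> * of_int k / of_nat (4 * n)))"
proof -
  let ?q = "exp (2 * of_real pi * \<i> * of_int k / of_nat (4 * n)) :: complex"
  define d where "d = nat (2 * int n div gcd k (2 * int n))"
  have "?q\<^sup>2 = exp (2 * (2 * of_real pi * \<i> * of_int k / of_nat (4 * n)))"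
    by (rule exp_double[symmetric])
  also have "\<dots> = cis (2 * pi * of_int k / of_nat (2 * n))"
    unfolding cis_conv_exp by (rule arg_cong[where f = exp]) (simp add: field_simps)
  finally have ord: "(?q\<^sup>2) ^ i = 1 \<longleftrightarrow> d dvd i" for i
    using root_of_unity_power_eq_1[of "2 * n" k i] n by (simp add: d_def)
  have g: "gcd k (2 * int n) dvd 2 * int n" "gcd k (2 * int n) > 0" using n by simp_all
  then have dg: "int d * gcd k (2 * int n) = 2 * int n"
    by (simp add: d_def pos_imp_zdiv_nonneg_iff)
  then have "d > 0" using n by (intro Nat.gr0I) simp
  moreover have "d dvd 2 * n"
  proof -
    have "int d dvd int (2 * n)" using dg by (metis dvd_triv_left of_nat_mult of_nat_numeral)
    then show ?thesis by (simp only: int_dvd_int_iff)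
  qed
  ultimately have "poly (Cat_B n) ?q = (if d dvd n then of_nat ((2 * n div d) choose (n div d)) else 0)"
    using ord by (intro poly_Cat_B_root_of_unity)
  then show ?thesis
    unfolding card_fixed_by_rotate_order card_periodic_words[OF n] d_def[symmetric]
    by (simp only: if_distrib[of of_nat] of_nat_0)
qed

end

theorem theorem9p3:
  fixes n :: nat and C :: "('g, 'm) monoid_scheme" and g :: 'g
  assumes "n \<ge> 2"
    and "cyclic_of_order C g (4 * n)"
  shows "\<exists>\<phi>. group_action C (carrier (CTam n)) \<phi> \<and>
    (\<forall>x\<in>carrier (CTam n). \<phi> g x = rowmotion (CTam n) x) \<and>
    cyclic_sieving (carrier (CTam n)) C g (4 * n) \<phi> (Cat_B n)"
proof -
  interpret T: cyclic_tamari n using assms(1) by unfold_locales simp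
  have C: "group C" and g: "g \<in> carrier C" and gen: "carrier C = generate C {g}"
    and ord: "Coset.order C = 4 * n"
    using assms(2) by (auto simp: cyclic_of_order_def)
  interpret C: group C by (rule C)
  let ?X = "carrier (CTam n)"
  have carrier: "carrier C = {g [^]\<^bsub>C\<^esub> (k::int) | k. k \<in> UNIV}"
    using gen C.generate_pow[OF g] by simp
  have ordg: "C.ord g = 4 * n"
    using C.generate_pow_card[OF g] gen ord by (simp add: Coset.order_def)
  define \<phi> where "\<phi> c = restrict (T.rotate_order (SOME k. c = g [^]\<^bsub>C\<^esub> k)) ?X" for c
  have \<phi>: "\<phi> (g [^]\<^bsub>C\<^esub> k) = restrict (T.rotate_order k) ?X" for k :: int
  proof -
    \<comment> \<open>Exponents are determined modulo \<open>4n\<close> only; the action is well defined because rotation by \<open>2n\<close> is already trivial.\<close>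
    define l where "l = (SOME l. g [^]\<^bsub>C\<^esub> k = g [^]\<^bsub>C\<^esub> (l::int))"
    have "g [^]\<^bsub>C\<^esub> k = g [^]\<^bsub>C\<^esub> l" unfolding l_def by (rule someI[of _ k]) simp
    then have "4 * int n dvd l - k" using C.int_pow_eq[OF g, of k l] ordg by simp
    then have "2 * int n dvd l - k" by (rule dvd_trans[rotated]) (simp add: dvd_def)
    then show ?thesis
      unfolding \<phi>_def l_def[symmetric] using T.rotate_order_cong by (intro restrict_ext) blast
  qed
  have Bij: "restrict (T.rotate_order k) ?X \<in> Bij ?X" for k
    using T.bij_rotate_order[of k] by (auto simp: Bij_def cong: bij_betw_cong)
  have action: "group_action C ?X \<phi>"
    unfolding group_action_def
  proof (intro group_hom.intro group_hom_axioms.intro homI)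
    show "group C" "group (BijGroup ?X)" using C group_BijGroup by blast+
    show "\<phi> c \<in> carrier (BijGroup ?X)" if "c \<in> carrier C" for c
      using that carrier \<phi> Bij by (auto simp: BijGroup_def)
    fix c d assume "c \<in> carrier C" "d \<in> carrier C"
    then obtain k l :: int where kl: "c = g [^]\<^bsub>C\<^esub> k" "d = g [^]\<^bsub>C\<^esub> l" using carrier by auto
    have "\<phi> (c \<otimes>\<^bsub>C\<^esub> d) = restrict (T.rotate_order (k + l)) ?X"
      unfolding kl C.int_pow_mult[OF g, symmetric] by (rule \<phi>)
    also have "\<dots> = compose ?X (\<phi> c) (\<phi> d)"
      unfolding kl \<phi> by (rule ext) (simp add: compose_def T.rotate_order_add T.rotate_order_in)
    also have "\<dots> = \<phi> c \<otimes>\<^bsub>BijGroup ?X\<^esub> \<phi> d"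
      using Bij unfolding kl \<phi> by (simp add: BijGroup_def)
    finally show "\<phi> (c \<otimes>\<^bsub>C\<^esub> d) = \<phi> c \<otimes>\<^bsub>BijGroup ?X\<^esub> \<phi> d" .
  qed
  have "\<phi> g x = rowmotion (CTam n) x" for x
    using \<phi>[of 1] C.int_pow_1[OF g] T.rowmotion_eq_rotate_order by simp
  moreover have "finite ?X"
    using T.bij_encode finite_words[OF T.n] by (simp add: bij_betw_finite)
  moreover have "card {x \<in> ?X. \<phi> (g [^]\<^bsub>C\<^esub> k) x = x} = card {x \<in> ?X. T.rotate_order k x = x}" for k :: int
    unfolding \<phi> by (rule arg_cong[where f = card]) auto
  ultimately show ?thesis
    using action assms(2) T.card_fixed_by_rotate_order_eq_Cat_B unfolding cyclic_sieving_def by auto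
qed

end
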